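(* Let $p$ be a prime, $n,m\ge1$, $q_1,\dots,q_m\in[1,\infty)$, $\alpha_1,\dots,\alpha_m\in(-n,\infty)$, $\beta_1,\dots,\beta_m\in\mathbb R$, $\ell_1,\dots,\ell_m\in[1,\infty)$, and define $\frac1q=\sum_i\frac1{q_i}$, $\frac\alpha q=\sum_i\frac{\alpha_i}{q_i}$, $\beta=\sum_i\beta_i$, $\frac1\ell=\sum_i\frac1{\ell_i}$. Let $\omega_i(x)=|x|_p^{\alpha_i}$, $\omega(x)=|x|_p^\alpha$, $\Omega\in L^{q'}(S_0)$, let $\lambda_1,\dots,\lambda_m>0$ and $\lambda^*=\lambda_1+\cdots+\lambda_m$. Then $\mathcal H^p_{\Phi,\Omega}$ is bounded from $MK^{\beta_1,\lambda_1}_{\ell_1,q_1,\omega_1}(\mathbb Q_p^n)\times\cdots\times MK^{\beta_m,\lambda_m}_{\ell_m,q_m,\omega_m}(\mathbb Q_p^n)$ to $MK^{\beta,\lambda^*}_{\ell,q,\omega}(\mathbb Q_p^n)$ if and only if $$\mathcal C_5=\sum_{\gamma\in\mathbb Z}\frac{\Phi(p^\gamma)}{p^{\gamma(1-\beta-\frac{n+\alpha}{q}+\lambda^* )}}<+\infty.$$ Moreover, $\|\mathcal H^p_{\Phi,\Omega}\|_{MK^{\beta_1,\lambda_1}_{\ell_1,q_1,\omega_1}\times\cdots\times MK^{\beta_m,\lambda_m}_{\ell_m,q_m,\omega_m}\to MK^{\beta,\lambda^*}_{\ell,q,\omega}}\simeq\mathcal C_5$.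
   Context: $\mathbb Q_p$ is the field of $p$-adic numbers with norm $|\cdot|_p$; on $\mathbb Q_p^n$, $|x|_p=\max_j|x_j|_p$. $S_k=\{|x|_p=p^k\}$, $\chi_k$ is its characteristic function, and $dx$ is Haar measure normalized by $|\{|x|_p\le1\}|=1$. $\Phi:\mathbb Q_p\to[0,\infty)$, $\Omega:S_0\to\mathbb C$ measurable, $\Omega\neq0$ a.e.; $q'$ is the conjugate exponent. The operator is $$\mathcal H^p_{\Phi,\Omega}(\vec f)(x)=\sum_{\gamma\in\mathbb Z}\int_{S_0}\frac{\Phi(p^\gamma)}{p^\gamma}\Omega(y)\prod_{i=1}^m f_i(p^\gamma|x|_p^{-1}y)\,dy.$$ $L^s_w$ has norm $(\int|f|^sw)^{1/s}$. The weighted Morrey-Herz space $MK^{b,\mu}_{l,s,w}(\mathbb Q_p^n)$ ($\mu\ge0$) consists of $f\in L^s_{w,\mathrm{loc}}(\mathbb Q_p^n\setminus\{0\})$ with $$\|f\|_{MK^{b,\mu}_{l,s,w}}=\sup_{k_0\in\mathbb Z}p^{-k_0\mu}\Big(\sum_{k=-\infty}^{k_0}p^{kbl}\|f\chi_k\|^l_{L^s_w}\Big)^{1/l}<\infty.$$ Bounded means $\|\mathcal H^p_{\Phi,\Omega}(\vec f)\|_Y\le C\prod_i\|f_i\|_{X_i}$, the operator norm being the least such $C$; $\simeq$ denotes two-sided comparability with positive constants independent of $\Phi$.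
   Formalization: The hypothesis Ω ∈ L^{q'}(S_0) is read as including q ≥ 1 (that is, Σ 1/q_i ≤ 1); for q < 1 the exponent q' is negative, the space is undefined, and the integrals defining the operator can diverge. *)

theory Defs
  imports "HOL-Analysis.Analysis"
begin

text \<open>An element of Q_p is represented by its p-adic digit expansion
  x = sum_k a_k p^k, i.e. a function a :: int => nat with 0 <= a_k < p and
  a_k = 0 for all sufficiently negative k.  An element of Q_p^n is a family of
  n such expansions, indexed by the components j < n (components j >= n are 0).\<close>

type_synonym qp1 = "int \<Rightarrow> nat"
type_synonym qpn = "nat \<Rightarrow> int \<Rightarrow> nat"

definition qp_space :: "nat \<Rightarrow> nat \<Rightarrow> qpn set" where
  "qp_space p n = {x. (\<forall>j\<ge>n. x j = (\<lambda>_. 0)) \<and> (\<forall>j k. x j k < p) \<and>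
                      (\<exists>K. \<forall>j k. k < K \<longrightarrow> x j k = 0)}"

definition qp_zero :: qpn where
  "qp_zero = (\<lambda>_ _. 0)"

definition qp_pow :: "int \<Rightarrow> qp1" where
  "qp_pow \<gamma> = (\<lambda>k. if k = \<gamma> then 1 else 0)"

definition qp_ord :: "nat \<Rightarrow> qpn \<Rightarrow> int" where
  "qp_ord n x = (LEAST k. \<exists>j<n. x j k \<noteq> 0)"

definition qp_norm :: "nat \<Rightarrow> nat \<Rightarrow> qpn \<Rightarrow> real" where
  "qp_norm p n x = (if x = qp_zero then 0 else real p powr (- real_of_int (qp_ord n x)))"

text \<open>Multiplication of a vector by the scalar p^e (a shift of digits).\<close>
definition qp_dil :: "int \<Rightarrow> qpn \<Rightarrow> qpn" where
  "qp_dil e y = (\<lambda>j k. y j (k - e))"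

text \<open>p^gamma |x|_p^(-1) y, for x \<noteq> 0 (note |x|_p^(-1) = p^(ord x)).\<close>
definition qp_scale :: "nat \<Rightarrow> int \<Rightarrow> qpn \<Rightarrow> qpn \<Rightarrow> qpn" where
  "qp_scale n \<gamma> x y = qp_dil (\<gamma> + qp_ord n x) y"

definition qp_sphere :: "nat \<Rightarrow> nat \<Rightarrow> int \<Rightarrow> qpn set" where
  "qp_sphere p n k = {x \<in> qp_space p n. qp_norm p n x = real p powr real_of_int k}"

text \<open>Inverse Monna map: a real t >= 0 with base-p expansion t = sum_k d_k p^(-k-1)
  is sent to the p-adic number sum_k d_k p^k.  The Monna map is a measure isomorphism
  between Haar measure on Q_p and Lebesgue measure on [0,oo) (up to null sets), so the
  Haar measure on Q_p^n (normalised by |{|x|_p <= 1}| = 1) is the push-forward of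
  Lebesgue measure on [0,oo)^n.\<close>
definition qp_digits :: "nat \<Rightarrow> real \<Rightarrow> qp1" where
  "qp_digits p t = (\<lambda>k. nat (\<lfloor>t * real p powr real_of_int (k + 1)\<rfloor> mod int p))"

definition qpn_embed :: "nat \<Rightarrow> nat \<Rightarrow> (nat \<Rightarrow> real) \<Rightarrow> qpn" where
  "qpn_embed p n t = (\<lambda>j. if j < n then qp_digits p (t j) else (\<lambda>_. 0))"

text \<open>Measurable space: product (cylinder) sigma-algebra restricted to Q_p^n
  (this is the Borel sigma-algebra of Q_p^n).\<close>
definition qp_mspace :: "nat \<Rightarrow> nat \<Rightarrow> qpn measure" where
  "qp_mspace p n = restrict_space (PiM UNIV (\<lambda>_. PiM UNIV (\<lambda>_. count_space UNIV))) (qp_space p n)"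

definition qp_haar :: "nat \<Rightarrow> nat \<Rightarrow> qpn measure" where
  "qp_haar p n = distr (restrict_space (PiM {..<n} (\<lambda>_. lborel)) {t. \<forall>j<n. 0 \<le> t j})
                       (qp_mspace p n) (qpn_embed p n)"

definition conj_exp :: "real \<Rightarrow> ereal" where
  "conj_exp q = (if q = 1 then \<infinity> else ereal (q / (q - 1)))"

definition Lp_on :: "'a measure \<Rightarrow> 'a set \<Rightarrow> ereal \<Rightarrow> ('a \<Rightarrow> complex) \<Rightarrow> bool" where
  "Lp_on M S r g \<longleftrightarrow> g \<in> borel_measurable (restrict_space M S) \<and>
     (if r = \<infinity> then (\<exists>C. AE y in M. y \<in> S \<longrightarrow> cmod (g y) \<le> C)
      else if 0 < r then (\<integral>\<^sup>+ y. ennreal (cmod (g y) powr real_of_ereal r * indicator S y) \<partial>M) < \<infinity>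
      else False)"

definition epow :: "ennreal \<Rightarrow> real \<Rightarrow> ennreal" where
  "epow x r = (if x = \<infinity> then \<infinity> else ennreal (enn2real x powr r))"

definition wL_norm_shell :: "nat \<Rightarrow> nat \<Rightarrow> real \<Rightarrow> (qpn \<Rightarrow> real) \<Rightarrow> (qpn \<Rightarrow> complex) \<Rightarrow> int \<Rightarrow> ennreal" where
  "wL_norm_shell p n s w f k =
     epow (\<integral>\<^sup>+ x. ennreal (cmod (f x) powr s * w x * indicator (qp_sphere p n k) x) \<partial>qp_haar p n) (1 / s)"

definition MK_norm :: "nat \<Rightarrow> nat \<Rightarrow> real \<Rightarrow> real \<Rightarrow> real \<Rightarrow> real \<Rightarrow> (qpn \<Rightarrow> real) \<Rightarrow> (qpn \<Rightarrow> complex) \<Rightarrow> ennreal" where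
  "MK_norm p n b \<mu> l s w f =
     (SUP k0::int. ennreal (real p powr (- real_of_int k0 * \<mu>)) *
        epow (\<Sum>i::nat. ennreal (real p powr (real_of_int (k0 - int i) * b * l)) *
                        epow (wL_norm_shell p n s w f (k0 - int i)) l) (1 / l))"

text \<open>f \<in> MK^{b,mu}_{l,s,w}: measurable with finite norm (finite norm already forces
  f chi_k \<in> L^s_w for every k, i.e. f \<in> L^s_{w,loc}(Q_p^n \ {0})).\<close>
definition MK_space :: "nat \<Rightarrow> nat \<Rightarrow> real \<Rightarrow> real \<Rightarrow> real \<Rightarrow> real \<Rightarrow> (qpn \<Rightarrow> real) \<Rightarrow> (qpn \<Rightarrow> complex) set" where
  "MK_space p n b \<mu> l s w =
     {f. f \<in> borel_measurable (qp_haar p n) \<and> MK_norm p n b \<mu> l s w f < \<infinity>}"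

definition pw :: "nat \<Rightarrow> nat \<Rightarrow> real \<Rightarrow> qpn \<Rightarrow> real" where
  "pw p n a x = qp_norm p n x powr a"

definition H_integrand :: "nat \<Rightarrow> nat \<Rightarrow> nat \<Rightarrow> (qp1 \<Rightarrow> real) \<Rightarrow> (qpn \<Rightarrow> complex) \<Rightarrow>
    (nat \<Rightarrow> qpn \<Rightarrow> complex) \<Rightarrow> qpn \<Rightarrow> int \<Rightarrow> qpn \<Rightarrow> complex" where
  "H_integrand p n m \<Phi> \<Omega> f x \<gamma> y =
     complex_of_real (\<Phi> (qp_pow \<gamma>) / real p powr real_of_int \<gamma>) * \<Omega> y *
     (\<Prod>i<m. f i (qp_scale n \<gamma> x y))"

definition H_term :: "nat \<Rightarrow> nat \<Rightarrow> nat \<Rightarrow> (qp1 \<Rightarrow> real) \<Rightarrow> (qpn \<Rightarrow> complex) \<Rightarrow>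
    (nat \<Rightarrow> qpn \<Rightarrow> complex) \<Rightarrow> qpn \<Rightarrow> int \<Rightarrow> complex" where
  "H_term p n m \<Phi> \<Omega> f x \<gamma> =
     (LINT y : qp_sphere p n 0 | qp_haar p n. H_integrand p n m \<Phi> \<Omega> f x \<gamma> y)"

definition H_op :: "nat \<Rightarrow> nat \<Rightarrow> nat \<Rightarrow> (qp1 \<Rightarrow> real) \<Rightarrow> (qpn \<Rightarrow> complex) \<Rightarrow>
    (nat \<Rightarrow> qpn \<Rightarrow> complex) \<Rightarrow> qpn \<Rightarrow> complex" where
  "H_op p n m \<Phi> \<Omega> f x = (\<Sum>\<^sub>\<infinity>\<gamma>::int. H_term p n m \<Phi> \<Omega> f x \<gamma>)"

definition H_defined :: "nat \<Rightarrow> nat \<Rightarrow> nat \<Rightarrow> (qp1 \<Rightarrow> real) \<Rightarrow> (qpn \<Rightarrow> complex) \<Rightarrow>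
    (nat \<Rightarrow> qpn \<Rightarrow> complex) \<Rightarrow> qpn \<Rightarrow> bool" where
  "H_defined p n m \<Phi> \<Omega> f x \<longleftrightarrow>
     (\<forall>\<gamma>. set_integrable (qp_haar p n) (qp_sphere p n 0) (H_integrand p n m \<Phi> \<Omega> f x \<gamma>)) \<and>
     (H_term p n m \<Phi> \<Omega> f x) summable_on UNIV"

definition H_bound :: "nat \<Rightarrow> nat \<Rightarrow> nat \<Rightarrow> (qp1 \<Rightarrow> real) \<Rightarrow> (qpn \<Rightarrow> complex) \<Rightarrow>
    (nat \<Rightarrow> real) \<Rightarrow> (nat \<Rightarrow> real) \<Rightarrow> (nat \<Rightarrow> real) \<Rightarrow> (nat \<Rightarrow> real) \<Rightarrow> (nat \<Rightarrow> qpn \<Rightarrow> real) \<Rightarrow>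
    real \<Rightarrow> real \<Rightarrow> real \<Rightarrow> real \<Rightarrow> (qpn \<Rightarrow> real) \<Rightarrow> real \<Rightarrow> bool" where
  "H_bound p n m \<Phi> \<Omega> bs mus ls ss ws b mu l s w C \<longleftrightarrow>
     (\<forall>f. (\<forall>i<m. f i \<in> MK_space p n (bs i) (mus i) (ls i) (ss i) (ws i)) \<longrightarrow>
        (\<forall>x\<in>qp_space p n. x \<noteq> qp_zero \<longrightarrow> H_defined p n m \<Phi> \<Omega> f x) \<and>
        H_op p n m \<Phi> \<Omega> f \<in> MK_space p n b mu l s w \<and>
        MK_norm p n b mu l s w (H_op p n m \<Phi> \<Omega> f)
          \<le> ennreal C * (\<Prod>i<m. MK_norm p n (bs i) (mus i) (ls i) (ss i) (ws i) (f i)))"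

definition H_bounded where
  "H_bounded p n m \<Phi> \<Omega> bs mus ls ss ws b mu l s w \<longleftrightarrow>
     (\<exists>C\<ge>0. H_bound p n m \<Phi> \<Omega> bs mus ls ss ws b mu l s w C)"

definition H_opnorm where
  "H_opnorm p n m \<Phi> \<Omega> bs mus ls ss ws b mu l s w =
     Inf {C. 0 \<le> C \<and> H_bound p n m \<Phi> \<Omega> bs mus ls ss ws b mu l s w C}"

end

theory Submission
  imports Defs
begin

text \<open>
  The value of the operator at \<open>x\<close> depends only on \<open>|x|\<close>, and membership of \<open>f i\<close> in a Morrey-Herz
  space bounds its norm on every sphere separately. Hoelder's inequality on the unit sphere
  therefore dominates the image pointwise by a constant times \<open>C5\<close> times a power of \<open>|x|\<close>; since
  the Morrey exponent is positive, that power lies in the target space (a geometric series), and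
  neither Minkowski's inequality nor Hoelder's inequality for the sums over \<open>k\<close> is needed, so
  that a target exponent below 1 does no harm.

  Conversely, powers of \<open>|x|\<close> with the critical exponents, one of them twisted by the phase of
  \<open>\<Omega>\<close>, are mapped to exactly \<open>C5\<close> times the integral of \<open>|\<Omega>|\<close> times a power of \<open>|x|\<close>.
\<close>

section \<open>Hoelder's inequality and infinite sums\<close>

text \<open>The exponent \<open>crit i\<close> balances the weight, the sum over spheres and the
  Morrey factor: for that power of |x| the expression under the supremum is the same for every
  \<open>k0\<close>. As \<open>lam i\<close> is positive, the sum over spheres converges, so the
  power itself lies in the space and serves as a test function without truncation or perturbation.
  The same exponent governs the bound on a single sphere, and the exponents add up to that of the
  target because 1/Q, A/Q, B and Lam are sums over i. Hence the estimates from above and from below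
  meet in the same series.

  Neither constant may depend on \<Phi>. The upper one is a Hoelder constant of \<Omega> times the
  target norm of the critical power; the lower one combines the integral of |\<Omega>|, the same
  target norm and bounds for the norms of the test functions.

  Haar measure enters through two facts: multiplication by p^e scales it by p^(-e n), and the unit
  sphere has finite positive measure. Both are carried over from Lebesgue measure by the digit
  map.\<close>

lemma weighted_arith_geom_mean:
  fixes x w :: "'i \<Rightarrow> real"
  assumes "finite I" "\<And>i. i \<in> I \<Longrightarrow> 0 \<le> x i" "\<And>i. i \<in> I \<Longrightarrow> 0 < w i" "sum w I = 1"
  shows "(\<Prod>i\<in>I. x i powr w i) \<le> (\<Sum>i\<in>I. w i * x i)"
proof (cases "\<exists>i\<in>I. x i = 0")
  case True
  then have "(\<Prod>i\<in>I. x i powr w i) = 0" using assms(1) by auto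
  also have "\<dots> \<le> (\<Sum>i\<in>I. w i * x i)"
    using assms by (intro sum_nonneg mult_nonneg_nonneg) (auto simp: less_imp_le)
  finally show ?thesis .
next
  case False
  then have pos: "0 < x i" if "i \<in> I" for i using assms(2)[OF that] that by force
  have "I \<noteq> {}" using assms(4) by auto
  have "ln (\<Sum>i\<in>I. w i *\<^sub>R x i) \<ge> (\<Sum>i\<in>I. w i * ln (x i))"
    by (intro concave_on_sum[OF assms(1) \<open>I \<noteq> {}\<close> ln_concave assms(4)])
      (use assms pos in \<open>auto simp: less_imp_le\<close>)
  moreover have "0 < (\<Sum>i\<in>I. w i * x i)"
    using assms pos \<open>I \<noteq> {}\<close> by (intro sum_pos) auto
  ultimately have "exp (\<Sum>i\<in>I. w i * ln (x i)) \<le> (\<Sum>i\<in>I. w i * x i)"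
    by (simp add: ln_ge_iff)
  moreover have "exp (\<Sum>i\<in>I. w i * ln (x i)) = (\<Prod>i\<in>I. x i powr w i)"
    unfolding exp_sum[OF assms(1)]
    by (intro prod.cong) (use False in \<open>auto simp: powr_def\<close>)
  ultimately show ?thesis by simp
qed

text \<open>Hoelder's inequality for all factors at once: after division by \<open>N i\<close>, the
  weighted mean inequality bounds the product pointwise by a convex combination of functions whose
  integrals are at most 1. Bounds \<open>N i\<close> in place of the integrals themselves keep the
  right-hand side real.\<close>

lemma nn_integral_prod_powr_le:
  fixes g :: "'i \<Rightarrow> 'a \<Rightarrow> real" and w N :: "'i \<Rightarrow> real"
  assumes I: "finite I" and w: "\<And>i. i \<in> I \<Longrightarrow> 0 < w i" "sum w I = 1"
    and g [measurable]: "\<And>i. i \<in> I \<Longrightarrow> g i \<in> borel_measurable M"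
    and g0: "\<And>i x. i \<in> I \<Longrightarrow> 0 \<le> g i x"
    and N0: "\<And>i. i \<in> I \<Longrightarrow> 0 \<le> N i"
    and N: "\<And>i. i \<in> I \<Longrightarrow> (\<integral>\<^sup>+ x. ennreal (g i x) \<partial>M) \<le> ennreal (N i)"
  shows "(\<integral>\<^sup>+ x. ennreal (\<Prod>i\<in>I. g i x powr w i) \<partial>M) \<le> ennreal (\<Prod>i\<in>I. N i powr w i)"
proof (cases "\<exists>i\<in>I. N i = 0")
  \<comment> \<open>Normalising by \<open>N j = 0\<close> is impossible, but then
    \<open>g j\<close>, and with it the product, vanishes almost everywhere.\<close>
  case True
  then obtain j where j: "j \<in> I" "N j = 0" by auto
  then have "(\<integral>\<^sup>+ x. ennreal (g j x) \<partial>M) = 0" using N[of j] by simp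
  then have "AE x in M. ennreal (g j x) = 0"
    using j by (subst (asm) nn_integral_0_iff_AE) auto
  then have "AE x in M. ennreal (\<Prod>i\<in>I. g i x powr w i) = 0"
  proof eventually_elim
    case (elim x)
    then have "g j x powr w j = 0" using g0[OF j(1), of x] by (auto simp: ennreal_eq_0_iff)
    then have "(\<Prod>i\<in>I. g i x powr w i) = 0" using I j(1) by (meson prod_zero)
    then show ?case by simp
  qed
  then have "(\<integral>\<^sup>+ x. ennreal (\<Prod>i\<in>I. g i x powr w i) \<partial>M) = (\<integral>\<^sup>+ x. 0 \<partial>M)"
    by (rule nn_integral_cong_AE)
  then show ?thesis by simp
next
  case False
  then have Npos: "0 < N i" if "i \<in> I" for i using N0[OF that] that by force
  define P where "P = (\<Prod>i\<in>I. N i powr w i)"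
  have P: "0 < P" using Npos unfolding P_def by (intro prod_pos) force
  have "(\<integral>\<^sup>+ x. ennreal (\<Prod>i\<in>I. g i x powr w i) \<partial>M) \<le>
      (\<integral>\<^sup>+ x. (\<Sum>i\<in>I. ennreal (P * w i / N i) * ennreal (g i x)) \<partial>M)"
  proof (rule nn_integral_mono)
    fix x
    have "(\<Prod>i\<in>I. g i x powr w i) = P * (\<Prod>i\<in>I. (g i x / N i) powr w i)"
      unfolding P_def prod.distrib[symmetric]
      by (intro prod.cong) (use Npos g0 False in \<open>auto simp: powr_divide\<close>)
    also have "\<dots> \<le> P * (\<Sum>i\<in>I. w i * (g i x / N i))"
      by (intro mult_left_mono weighted_arith_geom_mean I w)
        (use Npos g0 P in \<open>auto simp: less_imp_le\<close>)
    also have "\<dots> = (\<Sum>i\<in>I. (P * w i / N i) * g i x)"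
      by (simp add: sum_distrib_left mult.assoc)
    finally have "ennreal (\<Prod>i\<in>I. g i x powr w i) \<le> ennreal (\<Sum>i\<in>I. (P * w i / N i) * g i x)"
      by (rule ennreal_leI)
    also have "\<dots> = (\<Sum>i\<in>I. ennreal ((P * w i / N i) * g i x))"
      using Npos g0 P w by (intro sum_ennreal[symmetric]) (auto intro!: mult_nonneg_nonneg divide_nonneg_nonneg simp: less_imp_le)
    also have "\<dots> = (\<Sum>i\<in>I. ennreal (P * w i / N i) * ennreal (g i x))"
      using g0 by (intro sum.cong) (auto simp flip: ennreal_mult'')
    finally show "ennreal (\<Prod>i\<in>I. g i x powr w i) \<le> (\<Sum>i\<in>I. ennreal (P * w i / N i) * ennreal (g i x))" .
  qed
  also have "\<dots> = (\<Sum>i\<in>I. ennreal (P * w i / N i) * (\<integral>\<^sup>+ x. ennreal (g i x) \<partial>M))"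
    by (simp add: nn_integral_sum nn_integral_cmult)
  also have "\<dots> \<le> (\<Sum>i\<in>I. ennreal (P * w i / N i) * ennreal (N i))"
    by (intro sum_mono mult_left_mono N) auto
  also have "\<dots> = (\<Sum>i\<in>I. ennreal (P * w i))"
    using False N0 by (intro sum.cong) (auto simp flip: ennreal_mult'')
  also have "\<dots> = ennreal (\<Sum>i\<in>I. P * w i)"
    using P w by (intro sum_ennreal) (auto simp: less_imp_le)
  also have "(\<Sum>i\<in>I. P * w i) = P" using w by (simp flip: sum_distrib_left)
  finally show ?thesis by (simp add: P_def)
qed

text \<open>K is obtained before F and N are given. This order of quantifiers is what later makes
  the constant of the operator bound independent of \<Phi> and of the input functions.\<close>

lemma Lp_on_conj_exp_holder:
  fixes q :: "nat \<Rightarrow> real"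
  assumes S: "S \<in> sets M" and m: "1 \<le> m" and q: "\<forall>i<m. 1 \<le> q i"
    and Lp: "Lp_on M S (conj_exp (1 / (\<Sum>i<m. 1 / q i))) W"
  obtains K where "0 < K"
    "\<And>F N. (\<And>i. i < m \<Longrightarrow> F i \<in> borel_measurable M) \<Longrightarrow> (\<And>i. i < m \<Longrightarrow> 0 \<le> N i) \<Longrightarrow>
       (\<And>i. i < m \<Longrightarrow> (\<integral>\<^sup>+ y. ennreal (cmod (F i y) powr q i) * indicator S y \<partial>M) \<le> ennreal (N i)) \<Longrightarrow>
       (\<integral>\<^sup>+ y. ennreal (cmod (W y) * (\<Prod>i<m. cmod (F i y))) * indicator S y \<partial>M)
         \<le> ennreal (K * (\<Prod>i<m. N i powr (1 / q i)))"
proof -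
  define R where "R = restrict_space M S"
  have nn: "(\<integral>\<^sup>+ y. f y * indicator S y \<partial>M) = (\<integral>\<^sup>+ y. f y \<partial>R)" for f
    unfolding R_def by (rule nn_integral_restrict_space[symmetric]) (use S in auto)
  have W [measurable]: "W \<in> borel_measurable R"
    using Lp by (auto simp: Lp_on_def R_def)
  define s where "s = (\<Sum>i<m. 1 / q i)"
  have s0: "0 < s" unfolding s_def using m q by (intro sum_pos) (auto simp: lessThan_empty_iff intro: less_le_trans)
  have FR: "F \<in> borel_measurable R" if "F \<in> borel_measurable M" for F :: "'a \<Rightarrow> complex"
    using that unfolding R_def by (rule measurable_restrict_space1)
  have pp: "(cmod z powr q i) powr (1 / q i) = cmod z" if "i < m" for z i
    using q that by (force simp: powr_powr)
  show thesis
  proof (cases "s = 1")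
    case True
    then obtain C where "AE y in M. y \<in> S \<longrightarrow> cmod (W y) \<le> C"
      using Lp by (auto simp: Lp_on_def conj_exp_def s_def)
    then have C: "AE y in R. cmod (W y) \<le> C"
      unfolding R_def using S by (subst AE_restrict_space_iff) auto
    show thesis
    proof (rule that)
      show "0 < max C 1" by simp
    next
      fix F :: "nat \<Rightarrow> 'a \<Rightarrow> complex" and N :: "nat \<Rightarrow> real"
      assume F: "\<And>i. i < m \<Longrightarrow> F i \<in> borel_measurable M" and N: "\<And>i. i < m \<Longrightarrow> 0 \<le> N i"
        "\<And>i. i < m \<Longrightarrow> (\<integral>\<^sup>+ y. ennreal (cmod (F i y) powr q i) * indicator S y \<partial>M) \<le> ennreal (N i)"
      note [measurable] = FR[OF F]
      have "(\<integral>\<^sup>+ y. ennreal (cmod (W y) * (\<Prod>i<m. cmod (F i y))) \<partial>R) \<le>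
          (\<integral>\<^sup>+ y. ennreal (max C 1) * ennreal (\<Prod>i<m. (cmod (F i y) powr q i) powr (1 / q i)) \<partial>R)"
      proof (rule nn_integral_mono_AE, use C in eventually_elim)
        case (elim y)
        then have "cmod (W y) * (\<Prod>i<m. cmod (F i y)) \<le> max C 1 * (\<Prod>i<m. cmod (F i y))"
          by (intro mult_right_mono prod_nonneg) auto
        then show ?case
          by (simp add: pp prod_nonneg flip: ennreal_mult'')
      qed
      also have "\<dots> = ennreal (max C 1) * (\<integral>\<^sup>+ y. ennreal (\<Prod>i<m. (cmod (F i y) powr q i) powr (1 / q i)) \<partial>R)"
        by (intro nn_integral_cmult) measurable
      also have "\<dots> \<le> ennreal (max C 1) * ennreal (\<Prod>i<m. N i powr (1 / q i))"
        using True q N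
        by (intro mult_left_mono nn_integral_prod_powr_le) (auto simp: nn s_def intro: less_le_trans)
      also have "\<dots> = ennreal (max C 1 * (\<Prod>i<m. N i powr (1 / q i)))"
        by (simp add: ennreal_mult'' prod_nonneg)
      finally show "(\<integral>\<^sup>+ y. ennreal (cmod (W y) * (\<Prod>i<m. cmod (F i y))) * indicator S y \<partial>M)
         \<le> ennreal (max C 1 * (\<Prod>i<m. N i powr (1 / q i)))" by (simp add: nn)
    qed
  next
    case False
    define r where "r = 1 / s / (1 / s - 1)"
    have "conj_exp (1 / s) = ereal r" using False s0 by (simp add: conj_exp_def r_def)
    \<comment> \<open>\<open>Lp_on\<close> is false for a finite exponent that is not positive, so
      the hypothesis on W already excludes s > 1, that is, a target exponent below 1.\<close>
    then have r0: "0 < r" and Wr: "(\<integral>\<^sup>+ y. ennreal (cmod (W y) powr r * indicator S y) \<partial>M) < \<infinity>"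
      using Lp by (auto simp: Lp_on_def s_def split: if_splits)
    have r1: "1 / r = 1 - s" using s0 False by (simp add: r_def field_simps)
    have fin: "(\<integral>\<^sup>+ y. ennreal (cmod (W y) powr r) \<partial>R) < \<infinity>"
      using Wr by (simp add: ennreal_mult'' ennreal_indicator flip: nn)
    have ppW: "(cmod z powr r) powr (1 / r) = cmod z" for z
      using r0 by (simp add: powr_powr)
    \<comment> \<open>A strict majorant of the integral, so that the constant stays positive even if
      W vanishes almost everywhere.\<close>
    obtain V where V: "(\<integral>\<^sup>+ y. ennreal (cmod (W y) powr r) \<partial>R) \<le> ennreal V" "0 < V"
    proof (cases "\<integral>\<^sup>+ y. ennreal (cmod (W y) powr r) \<partial>R")
      case (real v)
      then show thesis by (intro that[of "v + 1"]) (auto simp: ennreal_leI)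
    qed (use fin in auto)
    show thesis
    proof (rule that)
      show "0 < V powr (1 / r)" using V by simp
    next
      fix F :: "nat \<Rightarrow> 'a \<Rightarrow> complex" and N :: "nat \<Rightarrow> real"
      assume F: "\<And>i. i < m \<Longrightarrow> F i \<in> borel_measurable M" and N: "\<And>i. i < m \<Longrightarrow> 0 \<le> N i"
        "\<And>i. i < m \<Longrightarrow> (\<integral>\<^sup>+ y. ennreal (cmod (F i y) powr q i) * indicator S y \<partial>M) \<le> ennreal (N i)"
      note [measurable] = FR[OF F]
      \<comment> \<open>The index m is free, since the factors F are numbered below m. It carries W
        with weight 1/r, and 1/r = 1 - s makes all weights add up to 1.\<close>
      define g where "g i y = (if i = m then cmod (W y) powr r else cmod (F i y) powr q i)" for i y
      define v where "v i = (if i = m then 1 / r else 1 / q i)" for i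
      define N' where "N' i = (if i = m then V else N i)" for i
      have prod_split: "(\<Prod>i\<in>insert m {..<m}. h i) = h m * (\<Prod>i<m. h i)" for h :: "nat \<Rightarrow> real"
        by simp
      have prod_g: "(\<Prod>i\<in>insert m {..<m}. g i y powr v i) = cmod (W y) * (\<Prod>i<m. cmod (F i y))" for y
        unfolding prod_split using r0 by (simp add: g_def v_def ppW pp cong: prod.cong_simp)
      have "(\<integral>\<^sup>+ y. ennreal (\<Prod>i\<in>insert m {..<m}. g i y powr v i) \<partial>R) \<le>
          ennreal (\<Prod>i\<in>insert m {..<m}. N' i powr v i)"
      proof (rule nn_integral_prod_powr_le)
        show "sum v (insert m {..<m}) = 1" using r1 by (simp add: v_def s_def)
        show "0 < v i" if "i \<in> insert m {..<m}" for i
          using that r0 q by (auto simp: v_def intro: less_le_trans)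
        show "g i \<in> borel_measurable R" if "i \<in> insert m {..<m}" for i
          using that by (cases "i = m") (auto simp: g_def[abs_def])
        show "(\<integral>\<^sup>+ y. ennreal (g i y) \<partial>R) \<le> ennreal (N' i)" if "i \<in> insert m {..<m}" for i
          using that V N by (cases "i = m") (auto simp: g_def N'_def nn)
      qed (use V N in \<open>auto simp: g_def N'_def\<close>)
      also have "(\<Prod>i\<in>insert m {..<m}. N' i powr v i) = V powr (1 / r) * (\<Prod>i<m. N i powr (1 / q i))"
        unfolding prod_split by (simp add: N'_def v_def)
      finally show "(\<integral>\<^sup>+ y. ennreal (cmod (W y) * (\<Prod>i<m. cmod (F i y))) * indicator S y \<partial>M)
         \<le> ennreal (V powr (1 / r) * (\<Prod>i<m. N i powr (1 / q i)))"
        by (simp only: nn prod_g)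
    qed
  qed
qed

section \<open>Unordered nonnegative sums and powers in the extended reals\<close>

lemma infsum_ennreal_eq:
  fixes f :: "'a \<Rightarrow> real"
  assumes "f summable_on A" "\<And>x. x \<in> A \<Longrightarrow> 0 \<le> f x"
  shows "(\<Sum>\<^sub>\<infinity>x\<in>A. ennreal (f x)) = ennreal (\<Sum>\<^sub>\<infinity>x\<in>A. f x)"
proof -
  have "(\<Sum>\<^sub>\<infinity>x\<in>A. ennreal (f x)) = (SUP F\<in>{F. finite F \<and> F \<subseteq> A}. (\<Sum>x\<in>F. ennreal (f x)))"
    by (rule nonneg_infsum_complete) simp
  also have "\<dots> = (SUP F\<in>{F. finite F \<and> F \<subseteq> A}. ennreal (sum f F))"
    using assms(2) by (intro SUP_cong) (auto intro!: sum_ennreal)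
  also have "\<dots> = ennreal (infsum f A)"
    using assms by (rule infsum_nonneg_is_SUPREMUM_ennreal[symmetric])
  finally show ?thesis .
qed

text \<open>Links the finiteness condition on C5, an extended sum, with the real summability in
  which the operator estimates are carried out.\<close>

lemma summable_on_iff_infsum_ennreal:
  fixes f :: "'a \<Rightarrow> real"
  assumes "\<And>x. x \<in> A \<Longrightarrow> 0 \<le> f x"
  shows "f summable_on A \<longleftrightarrow> (\<Sum>\<^sub>\<infinity>x\<in>A. ennreal (f x)) < \<infinity>"
proof
  assume "(\<Sum>\<^sub>\<infinity>x\<in>A. ennreal (f x)) < \<infinity>"
  then obtain B where B: "(\<Sum>\<^sub>\<infinity>x\<in>A. ennreal (f x)) = ennreal B" "0 \<le> B"
    by (cases "\<Sum>\<^sub>\<infinity>x\<in>A. ennreal (f x)") auto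
  show "f summable_on A"
  proof (rule nonneg_bdd_above_summable_on)
    show "bdd_above (sum f ` {F. F \<subseteq> A \<and> finite F})"
    proof (rule bdd_aboveI2)
      fix F assume F: "F \<in> {F. F \<subseteq> A \<and> finite F}"
      then have "ennreal (sum f F) = (\<Sum>x\<in>F. ennreal (f x))"
        using assms by (auto intro!: sum_ennreal[symmetric])
      also have "\<dots> \<le> (SUP F\<in>{F. finite F \<and> F \<subseteq> A}. (\<Sum>x\<in>F. ennreal (f x)))"
        using F by (intro SUP_upper) auto
      also have "\<dots> = ennreal B"
        using B(1) nonneg_infsum_complete[of A "\<lambda>x. ennreal (f x)"] by simp
      finally show "sum f F \<le> B" using B(2) by (simp add: ennreal_le_iff)
    qed
  qed (use assms in auto)
qed (simp add: infsum_ennreal_eq assms)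

lemma epow_ennreal: "0 \<le> a \<Longrightarrow> epow (ennreal a) r = ennreal (a powr r)"
  by (simp add: epow_def)

lemma epow_top [simp]: "epow top r = top"
  by (simp add: epow_def)

lemma epow_mono: "x \<le> y \<Longrightarrow> 0 \<le> r \<Longrightarrow> epow x r \<le> epow y r"
  by (cases x; cases y) (auto simp: epow_ennreal ennreal_le_iff powr_mono2 top_unique)

section \<open>The p-adic space and its Haar measure\<close>

text \<open>The product measure is determined by its values on boxes, and there the claim factors
  into the one-dimensional scaling of Lebesgue measure. Through the digit map this becomes the
  change of variables for Haar measure.\<close>

lemma PiM_lborel_scale:
  fixes c :: real
  assumes c: "0 < c"
    and h: "h \<in> borel_measurable (PiM {..<n::nat} (\<lambda>_. lborel))"
  shows "(\<integral>\<^sup>+ t. h (\<lambda>j\<in>{..<n}. c * t j) \<partial>PiM {..<n} (\<lambda>_. lborel)) =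
    ennreal (1 / c ^ n) * (\<integral>\<^sup>+ t. h t \<partial>PiM {..<n} (\<lambda>_. lborel))"
proof -
  interpret product_sigma_finite "\<lambda>_::nat. lborel :: real measure"
    by (simp add: product_sigma_finite_def sigma_finite_lborel)
  let ?M = "PiM {..<n} (\<lambda>_. lborel :: real measure)"
  let ?S = "\<lambda>t::nat \<Rightarrow> real. \<lambda>j\<in>{..<n}. c * t j"
  have S [measurable]: "?S \<in> measurable ?M ?M"
    by (intro measurable_restrict) measurable
  have "density (distr ?M ?M ?S) (\<lambda>_. ennreal (c ^ n)) = ?M"
  proof (rule PiM_eqI)
    fix A :: "nat \<Rightarrow> real set" assume A: "\<And>i. i \<in> {..<n} \<Longrightarrow> A i \<in> sets lborel"
    have PA [measurable]: "Pi\<^sub>E {..<n} A \<in> sets ?M"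
      using A by (intro sets_PiM_I_finite) auto
    have vim: "(\<lambda>x. c * x) -` A j \<in> sets borel" if "j < n" for j
    proof -
      have "(\<lambda>x. c * x) -` A j \<inter> space borel \<in> sets borel"
        by (rule measurable_sets[where A = borel]) (use A[of j] that in auto)
      then show ?thesis by simp
    qed
    have "emeasure (density (distr ?M ?M ?S) (\<lambda>_. ennreal (c ^ n))) (Pi\<^sub>E {..<n} A) =
        ennreal (c ^ n) * emeasure (distr ?M ?M ?S) (Pi\<^sub>E {..<n} A)"
      by (simp add: emeasure_density nn_integral_cmult_indicator)
    also have "emeasure (distr ?M ?M ?S) (Pi\<^sub>E {..<n} A) =
        emeasure ?M (?S -` Pi\<^sub>E {..<n} A \<inter> space ?M)"
      by (simp add: emeasure_distr)
    also have "?S -` Pi\<^sub>E {..<n} A \<inter> space ?M = Pi\<^sub>E {..<n} (\<lambda>j. (\<lambda>x. c * x) -` A j)"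
      by (auto simp: space_PiM PiE_iff extensional_def)
    also have "emeasure ?M \<dots> = (\<Prod>j<n. emeasure lborel ((\<lambda>x. c * x) -` A j))"
      by (intro emeasure_PiM) (auto simp: vim)
    also have "ennreal (c ^ n) * \<dots> = (\<Prod>j<n. ennreal c * emeasure lborel ((\<lambda>x. c * x) -` A j))"
      using c by (simp add: prod.distrib ennreal_power)
    also have "\<dots> = (\<Prod>j<n. emeasure lborel (A j))"
    proof (rule prod.cong)
      fix j assume j: "j \<in> {..<n}"
      have "emeasure lborel (A j) =
          emeasure (density (distr lborel borel (\<lambda>x. 0 + c * x)) (\<lambda>_. ennreal \<bar>c\<bar>)) (A j)"
        using lborel_real_affine[of c 0] c by simp
      also have "\<dots> = ennreal c * emeasure lborel ((\<lambda>x. c * x) -` A j)"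
        using A[OF j] c by (simp add: emeasure_density nn_integral_cmult_indicator emeasure_distr)
      finally show "ennreal c * emeasure lborel ((\<lambda>x. c * x) -` A j) = emeasure lborel (A j)" by simp
    qed simp
    finally show "emeasure (density (distr ?M ?M ?S) (\<lambda>_. ennreal (c ^ n))) (Pi\<^sub>E {..<n} A) =
        (\<Prod>j<n. emeasure lborel (A j))" .
  qed (auto)
  then have "(\<integral>\<^sup>+ t. h t \<partial>?M) = (\<integral>\<^sup>+ t. h t \<partial>density (distr ?M ?M ?S) (\<lambda>_. ennreal (c ^ n)))"
    by simp
  also have "\<dots> = ennreal (c ^ n) * (\<integral>\<^sup>+ t. h (?S t) \<partial>?M)"
    using h by (simp add: nn_integral_density nn_integral_distr nn_integral_cmult)
  finally show ?thesis
    using c by (simp flip: mult.assoc ennreal_mult'')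
qed

locale padic_space =
  fixes p n :: nat
  assumes p2: "2 \<le> p" and n1: "1 \<le> n"
begin

lemma space_qp_mspace [simp]: "space (qp_mspace p n) = qp_space p n"
  by (simp add: qp_mspace_def space_restrict_space space_PiM)

lemma sets_qp_haar [simp, measurable_cong]: "sets (qp_haar p n) = sets (qp_mspace p n)"
  by (simp add: qp_haar_def)

lemma space_qp_haar [simp]: "space (qp_haar p n) = qp_space p n"
  by (simp add: qp_haar_def)

lemma measurable_digit [measurable]: "(\<lambda>x. x j k) \<in> measurable (qp_mspace p n) (count_space UNIV)"
proof -
  have "(\<lambda>x. x j k) \<in> measurable (PiM UNIV (\<lambda>_::nat. PiM UNIV (\<lambda>_::int. count_space UNIV))) (count_space (UNIV :: nat set))"
    by (rule measurable_compose[OF measurable_component_singleton[of j] measurable_component_singleton[of k]]) auto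
  then show ?thesis
    unfolding qp_mspace_def by (rule measurable_restrict_space1)
qed

lemma measurable_qp_mspaceI:
  assumes "\<And>x. x \<in> space M \<Longrightarrow> f x \<in> qp_space p n"
    and "\<And>j k. (\<lambda>x. f x j k) \<in> measurable M (count_space UNIV)"
  shows "f \<in> measurable M (qp_mspace p n)"
  unfolding qp_mspace_def
  using assms by (intro measurable_restrict_space2 measurable_PiM_single') (auto simp: space_PiM)

lemma qp_ord_eqI:
  assumes "j < n" "x j e \<noteq> 0" "\<And>j k. j < n \<Longrightarrow> k < e \<Longrightarrow> x j k = 0"
  shows "qp_ord n x = e"
  unfolding qp_ord_def using assms by (intro Least_equality) (auto simp flip: not_less)

text \<open>The integers are not well-ordered, so the minimum in \<open>qp_ord\<close> exists only
  because the digits vanish below some K. Counting places from K turns it into a least natural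
  number.\<close>

lemma qp_ord_nonzero:
  assumes "x \<in> qp_space p n" "x \<noteq> qp_zero"
  obtains j where "j < n" "x j (qp_ord n x) \<noteq> 0" "\<And>j k. k < qp_ord n x \<Longrightarrow> x j k = 0"
proof -
  obtain K where K: "\<And>j k. k < K \<Longrightarrow> x j k = 0" and out: "\<And>j. j \<ge> n \<Longrightarrow> x j = (\<lambda>_. 0)"
    using assms(1) by (auto simp: qp_space_def)
  obtain j k where jk: "x j k \<noteq> 0"
    using assms(2) unfolding qp_zero_def fun_eq_iff by blast
  let ?P = "\<lambda>i::nat. \<exists>j. x j (K + int i) \<noteq> 0"
  have "k \<ge> K" using K jk by (meson not_less)
  then have "?P (nat (k - K))" using jk by auto
  then have 1: "?P (LEAST i. ?P i)" by (rule LeastI)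
  have 2: "\<not> ?P i" if "i < (LEAST i. ?P i)" for i using that by (rule not_less_Least)
  define e where "e = K + int (LEAST i. ?P i)"
  obtain j' where j': "x j' e \<noteq> 0" using 1 by (auto simp: e_def)
  have low: "x j k = 0" if "k < e" for j k
  proof (cases "k < K")
    case False
    then show ?thesis using 2[of "nat (k - K)"] that by (auto simp: e_def nat_less_iff)
  qed (use K in auto)
  have "j' < n" using j' out[of j'] by (metis not_less)
  then have "qp_ord n x = e" using j' low by (intro qp_ord_eqI) auto
  then show thesis using that \<open>j' < n\<close> j' low by auto
qed

lemma norm_pos: "x \<noteq> qp_zero \<Longrightarrow> 0 < qp_norm p n x"
  using p2 by (simp add: qp_norm_def)

lemma qp_sphere_iff:
  "x \<in> qp_sphere p n k \<longleftrightarrow> x \<in> qp_space p n \<and> x \<noteq> qp_zero \<and> qp_ord n x = - k"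
proof -
  have "real p powr a = real p powr b \<longleftrightarrow> a = b" for a b
    using p2 by (subst powr_inj) auto
  moreover have "real p powr a \<noteq> 0" for a
    using p2 by simp
  ultimately show ?thesis
    by (auto simp: qp_sphere_def qp_norm_def)
qed

lemma qp_dil_space:
  assumes "x \<in> qp_space p n"
  shows "qp_dil e x \<in> qp_space p n"
proof -
  obtain K where "\<forall>j k. k < K \<longrightarrow> x j k = 0"
    using assms by (auto simp: qp_space_def)
  then have "\<exists>K. \<forall>j k. k < K \<longrightarrow> x j (k - e) = 0" by (intro exI[of _ "K + e"]) auto
  then show ?thesis using assms by (auto simp: qp_space_def qp_dil_def)
qed

lemma qp_dil_dil: "qp_dil a (qp_dil b x) = qp_dil (a + b) x"
  by (simp add: qp_dil_def algebra_simps)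

lemma qp_dil_0 [simp]: "qp_dil 0 x = x"
  by (simp add: qp_dil_def)

lemma qp_dil_zero [simp]: "qp_dil e qp_zero = qp_zero"
  by (simp add: qp_dil_def qp_zero_def)

lemma qp_dil_eq_zero_iff [simp]: "qp_dil e x = qp_zero \<longleftrightarrow> x = qp_zero"
  by (metis add.left_inverse qp_dil_0 qp_dil_dil qp_dil_zero)

lemma qp_ord_dil:
  assumes "x \<in> qp_space p n" "x \<noteq> qp_zero"
  shows "qp_ord n (qp_dil e x) = e + qp_ord n x"
proof (rule qp_ord_nonzero[OF assms])
  fix j assume "j < n" "x j (qp_ord n x) \<noteq> 0" "\<And>j k. k < qp_ord n x \<Longrightarrow> x j k = 0"
  then show ?thesis by (intro qp_ord_eqI[of j]) (auto simp: qp_dil_def)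
qed

lemma qp_dil_sphere: "qp_dil e x \<in> qp_sphere p n k \<longleftrightarrow> x \<in> qp_sphere p n (k + e)" if "x \<in> qp_space p n"
  using that by (auto simp: qp_sphere_iff qp_dil_space qp_ord_dil)

lemma measurable_qp_dil [measurable]: "qp_dil e \<in> measurable (qp_mspace p n) (qp_mspace p n)"
  by (rule measurable_qp_mspaceI) (simp_all add: qp_dil_space, simp add: qp_dil_def)

lemma ord_level_iff:
  assumes "x \<in> qp_space p n" "x \<noteq> qp_zero"
  shows "qp_ord n x = e \<longleftrightarrow> (\<exists>j<n. x j e \<noteq> 0) \<and> (\<forall>j. \<forall>k. k < e \<longrightarrow> x j k = 0)"
  using qp_ord_nonzero[OF assms] qp_ord_eqI[of _ x e] by (metis)

lemma zero_set_measurable [measurable]: "Measurable.pred (qp_mspace p n) (\<lambda>x. x = qp_zero)"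
proof -
  have "(\<lambda>x. x = qp_zero) = (\<lambda>x. \<forall>j k. x j k = 0)"
    by (auto simp: qp_zero_def fun_eq_iff)
  then show ?thesis by simp
qed

text \<open>The order takes countably many values, so its level sets suffice, and these are
  conditions on digits. The origin is split off because \<open>LEAST\<close> has an unspecified
  value there.\<close>

lemma measurable_qp_ord [measurable]: "qp_ord n \<in> measurable (qp_mspace p n) (count_space UNIV)"
proof (rule measurable_count_space_eq2_countable[THEN iffD2], intro conjI ballI)
  fix e :: int
  have *: "qp_ord n -` {e} \<inter> space (qp_mspace p n) =
     {x \<in> space (qp_mspace p n). x = qp_zero \<and> qp_ord n qp_zero = e \<or>
       x \<noteq> qp_zero \<and> (\<exists>j\<in>{..<n}. x j e \<noteq> 0) \<and> (\<forall>j k. k < e \<longrightarrow> x j k = 0)}"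
    using ord_level_iff by (fastforce simp: Bex_def)
  show "qp_ord n -` {e} \<inter> space (qp_mspace p n) \<in> sets (qp_mspace p n)"
    unfolding * by measurable
qed auto

lemma measurable_qp_norm [measurable]: "qp_norm p n \<in> borel_measurable (qp_mspace p n)"
  unfolding qp_norm_def[abs_def] by measurable

lemma sphere_sets [measurable]: "qp_sphere p n k \<in> sets (qp_mspace p n)"
proof -
  have "qp_sphere p n k = {x \<in> space (qp_mspace p n). x \<noteq> qp_zero \<and> qp_ord n x = - k}"
    by (auto simp: qp_sphere_iff)
  also have "\<dots> \<in> sets (qp_mspace p n)" by measurable
  finally show ?thesis .
qed

section \<open>The digit map and the change of variables for Haar measure\<close>

lemma qp_digits_scale: "qp_digits p (real p powr (- real_of_int e) * t) k = qp_digits p t (k - e)"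
proof -
  have "real p powr (- real_of_int e) * t * real p powr real_of_int (k + 1) =
      t * real p powr real_of_int (k - e + 1)"
    using p2 by (simp add: powr_add powr_diff powr_minus field_simps)
  then show ?thesis unfolding qp_digits_def by (simp only:)
qed

lemma qp_digits_low:
  assumes "0 \<le> t" "t * real p powr real_of_int (k + 1) < 1"
  shows "qp_digits p t k = 0"
proof -
  have "\<lfloor>t * real p powr real_of_int (k + 1)\<rfloor> = 0"
    using assms by (simp add: floor_eq_iff)
  then show ?thesis by (simp add: qp_digits_def)
qed

lemma qpn_embed_space:
  assumes "\<forall>j<n. 0 \<le> t j"
  shows "qpn_embed p n t \<in> qp_space p n"
proof -
  define T where "T = 1 + (\<Sum>j<n. t j)"
  have T: "t j < T" if "j < n" for j
    using member_le_sum[of j "{..<n}" t] assms that by (simp add: T_def)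
  have T1: "1 \<le> T" using assms by (auto simp: T_def intro!: sum_nonneg)
  \<comment> \<open>T is at least 1 and strictly exceeds every coordinate. For k < K this gives
    p^(k+1) \<le> 1/T, so the number whose floor is taken lies below 1 and the digit is 0.\<close>
  define K where "K = - \<lceil>log (real p) T\<rceil> - 1"
  have "qpn_embed p n t j k = 0" if "k < K" for j k
  proof (cases "j < n")
    case True
    have "real_of_int (k + 1) \<le> - log (real p) T" using that unfolding K_def by linarith
    then have "real p powr real_of_int (k + 1) \<le> real p powr (- log (real p) T)"
      using p2 by (intro powr_mono) auto
    also have "\<dots> = 1 / T"
      using p2 T1 by (simp add: powr_minus divide_simps)
    finally have "t j * real p powr real_of_int (k + 1) \<le> t j * (1 / T)"
      using assms True by (intro mult_left_mono) auto
    also have "\<dots> < 1" using T[OF True] T1 by simp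
    finally show ?thesis using assms True by (simp add: qpn_embed_def qp_digits_low)
  qed (simp add: qpn_embed_def)
  then have "\<exists>K. \<forall>j k. k < K \<longrightarrow> qpn_embed p n t j k = 0" by blast
  moreover have "nat (z mod int p) < p" for z
    using p2 by (simp add: nat_less_iff)
  then have "\<forall>j k. qpn_embed p n t j k < p"
    using p2 by (simp add: qpn_embed_def qp_digits_def)
  moreover have "\<forall>j\<ge>n. qpn_embed p n t j = (\<lambda>_. 0)" by (simp add: qpn_embed_def)
  ultimately show ?thesis
    unfolding qp_space_def by simp
qed

text \<open>Shifting base-p digits is multiplication by a power of p on both sides of the digit map:
  the real coordinates and the p-adic norm shrink by the same factor p^(-e).\<close>

lemma qpn_embed_scale:
  "qpn_embed p n (\<lambda>j\<in>{..<n}. real p powr (- real_of_int e) * t j) = qp_dil e (qpn_embed p n t)"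
  by (auto simp: qpn_embed_def qp_dil_def fun_eq_iff qp_digits_scale)

abbreviation Rn :: "(nat \<Rightarrow> real) measure" where
  "Rn \<equiv> PiM {..<n} (\<lambda>_. lborel)"

abbreviation orthant :: "(nat \<Rightarrow> real) set" where
  "orthant \<equiv> {t. \<forall>j<n. 0 \<le> t j}"

lemma orthant_sets: "orthant \<inter> space Rn \<in> sets Rn"
proof -
  have "orthant \<inter> space Rn = {t \<in> space Rn. \<forall>j\<in>{..<n}. 0 \<le> t j}" by auto
  also have "\<dots> \<in> sets Rn" by measurable
  finally show ?thesis .
qed

lemma measurable_qpn_embed [measurable]:
  "qpn_embed p n \<in> measurable (restrict_space Rn orthant) (qp_mspace p n)"
proof (rule measurable_qp_mspaceI)
  fix j k
  show "(\<lambda>t. qpn_embed p n t j k) \<in> measurable (restrict_space Rn orthant) (count_space UNIV)"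
  proof (cases "j < n")
    case True
    have [measurable]: "(\<lambda>t. t j) \<in> borel_measurable Rn"
      using measurable_component_singleton[of j "{..<n}" "\<lambda>_. lborel :: real measure"] True by simp
    have "(\<lambda>t. \<lfloor>t j * real p powr real_of_int (k + 1)\<rfloor>) \<in> measurable Rn (count_space UNIV)"
      by measurable
    from measurable_compose[OF this, of "\<lambda>z. nat (z mod int p)" "count_space UNIV"]
    have "(\<lambda>t. nat (\<lfloor>t j * real p powr real_of_int (k + 1)\<rfloor> mod int p)) \<in> measurable Rn (count_space UNIV)"
      by simp
    then show ?thesis
      using True by (intro measurable_restrict_space1) (simp add: qpn_embed_def qp_digits_def)
  qed (simp add: qpn_embed_def)
qed (auto simp: space_restrict_space qpn_embed_space)

lemma nn_integral_qp_haar: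
  assumes [measurable]: "g \<in> borel_measurable (qp_mspace p n)"
  shows "(\<integral>\<^sup>+ x. g x \<partial>qp_haar p n) = (\<integral>\<^sup>+ t. g (qpn_embed p n t) * indicator orthant t \<partial>Rn)"
proof -
  have "(\<integral>\<^sup>+ x. g x \<partial>qp_haar p n) = (\<integral>\<^sup>+ t. g (qpn_embed p n t) \<partial>restrict_space Rn orthant)"
    unfolding qp_haar_def by (rule nn_integral_distr) simp_all
  also have "\<dots> = (\<integral>\<^sup>+ t. g (qpn_embed p n t) * indicator orthant t \<partial>Rn)"
    using orthant_sets by (rule nn_integral_restrict_space)
  finally show ?thesis .
qed

text \<open>The factor is the inverse of the modulus p^(-e n) of multiplication by p^e on Q_p^n. It
  is read off from Lebesgue measure, since scaling by a positive number preserves the orthant on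
  which the digit map is used.\<close>

lemma nn_integral_qp_dil:
  assumes g [measurable]: "g \<in> borel_measurable (qp_mspace p n)"
  shows "(\<integral>\<^sup>+ x. g (qp_dil e x) \<partial>qp_haar p n) =
    ennreal (real p powr (real_of_int e * real n)) * (\<integral>\<^sup>+ x. g x \<partial>qp_haar p n)"
proof -
  define c where "c = real p powr (- real_of_int e)"
  have c: "0 < c" using p2 by (simp add: c_def)
  define h where "h t = g (qpn_embed p n t) * indicator orthant t" for t
  have "(\<lambda>t. g (qpn_embed p n t)) \<in> borel_measurable (restrict_space Rn orthant)"
    by measurable
  then have h: "h \<in> borel_measurable Rn"
    unfolding h_def using orthant_sets by (simp add: borel_measurable_restrict_space_iff_ennreal)
  have "(\<integral>\<^sup>+ x. g (qp_dil e x) \<partial>qp_haar p n) = (\<integral>\<^sup>+ t. h (\<lambda>j\<in>{..<n}. c * t j) \<partial>Rn)"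
    using c by (subst nn_integral_qp_haar)
      (auto simp: h_def c_def qpn_embed_scale indicator_def zero_le_mult_iff intro!: nn_integral_cong)
  also have "\<dots> = ennreal (1 / c ^ n) * (\<integral>\<^sup>+ t. h t \<partial>Rn)"
    by (rule PiM_lborel_scale[OF c h])
  also have "1 / c ^ n = real p powr (real_of_int e * real n)"
    using p2 by (simp add: c_def powr_minus divide_simps powr_powr flip: powr_realpow)
  also have "(\<integral>\<^sup>+ t. h t \<partial>Rn) = (\<integral>\<^sup>+ x. g x \<partial>qp_haar p n)"
    by (simp add: nn_integral_qp_haar h_def)
  finally show ?thesis .
qed

definition sph :: real where
  "sph = measure (qp_haar p n) (qp_sphere p n 0)"

text \<open>Two boxes replace an exact computation. The preimage of the unit sphere lies in the
  closed unit cube, and it contains the half-open cube with the first coordinate restricted to [1/p,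
  1), where the digit at place 0 is nonzero.\<close>

lemma
  shows emeasure_sphere_0: "emeasure (qp_haar p n) (qp_sphere p n 0) = ennreal sph"
    and sph_pos: "0 < sph"
proof -
  interpret product_sigma_finite "\<lambda>_::nat. lborel :: real measure"
    by (simp add: product_sigma_finite_def sigma_finite_lborel)
  have eq: "emeasure (qp_haar p n) (qp_sphere p n 0) =
      (\<integral>\<^sup>+ t. indicator (qp_sphere p n 0) (qpn_embed p n t) * indicator orthant t \<partial>Rn)"
    by (subst nn_integral_qp_haar[symmetric]) auto
  define I where "I j = (if j = 0 then {1 / real p..<1} else {0..<1::real})" for j :: nat
  have I_meas: "Pi\<^sub>E {..<n} I \<in> sets Rn" "Pi\<^sub>E {..<n} (\<lambda>_. {0..1}) \<in> sets Rn"
    by (auto intro!: sets_PiM_I_finite simp: I_def)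
  have "(\<integral>\<^sup>+ t. indicator (qp_sphere p n 0) (qpn_embed p n t) * indicator orthant t \<partial>Rn) \<le>
      (\<integral>\<^sup>+ t. indicator (Pi\<^sub>E {..<n} (\<lambda>_. {0..1})) t \<partial>Rn)"
  proof (rule nn_integral_mono, goal_cases)
    case (1 t)
    have "t j \<le> 1" if sph: "qpn_embed p n t \<in> qp_sphere p n 0" and t: "t \<in> orthant" and j: "j < n" for j
    proof (rule ccontr)
      assume "\<not> t j \<le> 1"
      \<comment> \<open>p^K is the leading power of p in \<open>t j\<close>, so the digit at place -
        K - 1 is nonzero. This place is negative, against order 0.\<close>
      define K where "K = \<lfloor>log (real p) (t j)\<rfloor>"
      have "0 \<le> K" using p2 \<open>\<not> t j \<le> 1\<close> by (simp add: K_def)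
      have "real p powr K \<le> t j" "t j < real p powr (K + 1)"
        using floor_log_eq_powr_iff[of "t j" "real p" K] p2 \<open>\<not> t j \<le> 1\<close> by (auto simp: K_def)
      then have "1 \<le> t j * real p powr (- real_of_int K)" "t j * real p powr (- real_of_int K) < real p"
        using p2 by (auto simp: powr_minus powr_add field_simps)
      then have "1 \<le> \<lfloor>t j * real p powr (- real_of_int K)\<rfloor>" "\<lfloor>t j * real p powr (- real_of_int K)\<rfloor> < int p"
        by (auto simp: floor_less_iff)
      then have "qp_digits p (t j) (- K - 1) \<noteq> 0"
        by (simp add: qp_digits_def)
      then have "qpn_embed p n t j (- K - 1) \<noteq> 0" using j by (simp add: qpn_embed_def)
      moreover have "- K - 1 < qp_ord n (qpn_embed p n t)"
        using sph \<open>0 \<le> K\<close> by (simp add: qp_sphere_iff)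
      ultimately show False
        using sph qp_ord_nonzero[of "qpn_embed p n t"] by (metis qp_sphere_iff)
    qed
    with 1 show ?case
      by (auto simp: indicator_def space_PiM PiE_iff)
  qed
  also have "\<dots> = 1"
    using I_meas by (simp add: emeasure_PiM)
  finally have "emeasure (qp_haar p n) (qp_sphere p n 0) \<le> 1" by (simp add: eq)
  then show A: "emeasure (qp_haar p n) (qp_sphere p n 0) = ennreal sph"
    unfolding sph_def by (intro emeasure_eq_ennreal_measure) (auto simp: top_unique)
  have "ennreal (1 - 1 / real p) \<le> (\<Prod>j<n. emeasure lborel (I j))"
  proof -
    have "(\<Prod>j<n. emeasure lborel (I j)) = emeasure lborel (I 0) * (\<Prod>j\<in>{..<n}-{0}. emeasure lborel (I j))"
      using n1 by (intro prod.remove) auto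
    also have "(\<Prod>j\<in>{..<n}-{0}. emeasure lborel (I j)) = 1"
      by (intro prod.neutral) (auto simp: I_def)
    also have "emeasure lborel (I 0) = ennreal (1 - 1 / real p)"
      using p2 by (simp add: I_def)
    finally show ?thesis by simp
  qed
  also have "(\<Prod>j<n. emeasure lborel (I j)) = (\<integral>\<^sup>+ t. indicator (Pi\<^sub>E {..<n} I) t \<partial>Rn)"
    using I_meas by (simp add: emeasure_PiM I_def)
  also have "\<dots> \<le> (\<integral>\<^sup>+ t. indicator (qp_sphere p n 0) (qpn_embed p n t) * indicator orthant t \<partial>Rn)"
  proof (rule nn_integral_mono, goal_cases)
    case (1 t)
    have "qpn_embed p n t \<in> qp_sphere p n 0 \<and> t \<in> orthant" if t: "t \<in> Pi\<^sub>E {..<n} I"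
    proof -
      have t01: "0 \<le> t j" "t j < 1" if "j < n" for j
      proof -
        have "t j \<in> I j" using t that by auto
        then show "0 \<le> t j" "t j < 1" using p2 by (auto simp: I_def split: if_splits intro: order_trans[rotated])
      qed
      have "t 0 \<in> I 0" using t n1 by (auto simp: PiE_iff)
      then have "1 \<le> t 0 * real p" "t 0 * real p < real p"
        using p2 by (auto simp: I_def field_simps)
      then have "1 \<le> \<lfloor>t 0 * real p\<rfloor>" "\<lfloor>t 0 * real p\<rfloor> < int p"
        by (auto simp: floor_less_iff)
      then have d: "qpn_embed p n t 0 0 \<noteq> 0"
        using n1 p2 by (simp add: qpn_embed_def qp_digits_def)
      have "qpn_embed p n t j k = 0" if "j < n" "k < 0" for j k
      proof -
        have "real p powr real_of_int (k + 1) \<le> real p powr 0"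
          using p2 that by (intro powr_mono) auto
        then have "t j * real p powr real_of_int (k + 1) \<le> t j * 1"
          using t01[OF that(1)] p2 by (intro mult_left_mono) auto
        then show ?thesis
          using t01[OF that(1)] that by (simp add: qpn_embed_def qp_digits_low)
      qed
      then have "qp_ord n (qpn_embed p n t) = 0"
        using d n1 by (intro qp_ord_eqI[of 0]) auto
      moreover have "qpn_embed p n t \<noteq> qp_zero" using d by (auto simp: qp_zero_def)
      ultimately show ?thesis using t01 by (auto simp: qp_sphere_iff qpn_embed_space)
    qed
    then show ?case by (auto simp: indicator_def)
  qed
  finally have "ennreal (1 - 1 / real p) \<le> ennreal sph" by (simp add: eq A flip: eq)
  moreover have "0 < 1 - 1 / real p" using p2 by simp
  ultimately show "0 < sph"
    by (metis ennreal_le_iff2 less_le_trans not_less)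
qed

section \<open>Weighted Morrey-Herz norms\<close>

lemma qp_norm_sphere: "x \<in> qp_sphere p n k \<Longrightarrow> qp_norm p n x = real p powr real_of_int k"
  by (simp add: qp_sphere_def)

text \<open>Moves integrals over S_k, in which the norms are expressed, to S_0, over which the
  operator integrates.\<close>

lemma nn_integral_sphere_dil:
  assumes [measurable]: "g \<in> borel_measurable (qp_mspace p n)"
  shows "(\<integral>\<^sup>+ y. g (qp_dil (- k) y) * indicator (qp_sphere p n 0) y \<partial>qp_haar p n) =
    ennreal (real p powr (- real_of_int k * real n)) *
    (\<integral>\<^sup>+ x. g x * indicator (qp_sphere p n k) x \<partial>qp_haar p n)"
proof -
  have "(\<integral>\<^sup>+ y. g (qp_dil (- k) y) * indicator (qp_sphere p n 0) y \<partial>qp_haar p n) =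
      (\<integral>\<^sup>+ y. g (qp_dil (- k) y) * indicator (qp_sphere p n k) (qp_dil (- k) y) \<partial>qp_haar p n)"
    by (intro nn_integral_cong) (simp add: indicator_def qp_dil_sphere)
  also have "\<dots> = ennreal (real p powr (real_of_int (- k) * real n)) *
      (\<integral>\<^sup>+ x. g x * indicator (qp_sphere p n k) x \<partial>qp_haar p n)"
    by (rule nn_integral_qp_dil) measurable
  finally show ?thesis by simp
qed

lemma emeasure_sphere: "emeasure (qp_haar p n) (qp_sphere p n k) = ennreal (real p powr (real_of_int k * real n) * sph)"
proof -
  have "ennreal sph = ennreal (real p powr (- real_of_int k * real n)) * emeasure (qp_haar p n) (qp_sphere p n k)"
    using nn_integral_sphere_dil[of "\<lambda>_. 1" k] by (simp add: emeasure_sphere_0)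
  then have "ennreal (real p powr (real_of_int k * real n)) * ennreal sph =
      ennreal (real p powr (real_of_int k * real n)) * ennreal (real p powr (- real_of_int k * real n)) *
        emeasure (qp_haar p n) (qp_sphere p n k)"
    by (simp add: mult.assoc)
  also have "ennreal (real p powr (real_of_int k * real n)) * ennreal (real p powr (- real_of_int k * real n)) = 1"
    using p2 by (simp flip: ennreal_mult'' powr_add)
  finally show ?thesis using sph_pos by (simp add: ennreal_mult)
qed

lemma wL_norm_shell_pw:
  "wL_norm_shell p n s (pw p n \<alpha>) f k = epow (ennreal (real p powr (real_of_int k * \<alpha>)) *
     (\<integral>\<^sup>+ x. ennreal (cmod (f x) powr s) * indicator (qp_sphere p n k) x \<partial>qp_haar p n)) (1 / s)"
  if [measurable]: "f \<in> borel_measurable (qp_mspace p n)"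
proof -
  have "(\<integral>\<^sup>+ x. ennreal (cmod (f x) powr s * pw p n \<alpha> x * indicator (qp_sphere p n k) x) \<partial>qp_haar p n) =
      (\<integral>\<^sup>+ x. ennreal (real p powr (real_of_int k * \<alpha>)) *
        (ennreal (cmod (f x) powr s) * indicator (qp_sphere p n k) x) \<partial>qp_haar p n)"
    by (intro nn_integral_cong)
      (auto simp: indicator_def pw_def qp_norm_sphere powr_powr mult.commute ennreal_mult'')
  also have "\<dots> = ennreal (real p powr (real_of_int k * \<alpha>)) *
      (\<integral>\<^sup>+ x. ennreal (cmod (f x) powr s) * indicator (qp_sphere p n k) x \<partial>qp_haar p n)"
    by (intro nn_integral_cmult) measurable
  finally show ?thesis by (simp add: wL_norm_shell_def)
qed

lemma MK_norm_mono:
  assumes "\<And>x. x \<in> qp_space p n \<Longrightarrow> x \<noteq> qp_zero \<Longrightarrow> cmod (f x) \<le> cmod (g x)" "0 < s" "0 < l"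
  shows "MK_norm p n b \<mu> l s (pw p n \<alpha>) f \<le> MK_norm p n b \<mu> l s (pw p n \<alpha>) g"
proof -
  have "wL_norm_shell p n s (pw p n \<alpha>) f k \<le> wL_norm_shell p n s (pw p n \<alpha>) g k" for k
    unfolding wL_norm_shell_def
  proof (intro epow_mono nn_integral_mono ennreal_leI)
    fix x assume "x \<in> space (qp_haar p n)"
    then show "cmod (f x) powr s * pw p n \<alpha> x * indicator (qp_sphere p n k) x
        \<le> cmod (g x) powr s * pw p n \<alpha> x * indicator (qp_sphere p n k) x"
      using assms by (auto simp: indicator_def qp_sphere_iff pw_def intro!: mult_right_mono powr_mono2)
  qed (use assms in auto)
  then show ?thesis
    unfolding MK_norm_def using assms
    by (intro SUP_mono' mult_left_mono epow_mono suminf_le summableI) auto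
qed

text \<open>For a > 0, the sum of the geometric series with ratio p^(-a).\<close>

definition geo :: "real \<Rightarrow> real" where
  "geo a = 1 / (1 - real p powr (- a))"

lemma geo_pos: "0 < a \<Longrightarrow> 0 < geo a"
  using p2 powr_less_mono[of "- a" 0 "real p"] by (simp add: geo_def)

text \<open>With this exponent the norm on S_k times p^(k b) is a constant times p^(k \<mu>).
  Summing over k \<le> \<open>k0\<close> gives a geometric series, convergent because \<mu> > 0,
  whose total is proportional to p^(k0 \<mu>) after the root and cancels the Morrey factor. The
  supremum is thus over a constant, and equality holds.\<close>

lemma MK_norm_radial:
  assumes f: "f \<in> borel_measurable (qp_mspace p n)"
    and rad: "\<And>x. x \<in> qp_space p n \<Longrightarrow> x \<noteq> qp_zero \<Longrightarrow>
      cmod (f x) = c * qp_norm p n x powr (\<mu> - b - (real n + \<alpha>) / s)"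
    and c: "0 \<le> c" and pos: "0 < s" "0 < l" "0 < \<mu>"
  shows "MK_norm p n b \<mu> l s (pw p n \<alpha>) f = ennreal (c * (sph powr (1 / s) * geo (\<mu> * l) powr (1 / l)))"
proof -
  have P: "real p powr a \<noteq> 0" "0 < real p powr a" for a using p2 by auto
  have wL: "wL_norm_shell p n s (pw p n \<alpha>) f k =
      ennreal (c * sph powr (1 / s) * real p powr (real_of_int k * (\<mu> - b)))" for k
  proof -
    define a where "a = \<mu> - b - (real n + \<alpha>) / s"
    have "(\<integral>\<^sup>+ x. ennreal (cmod (f x) powr s) * indicator (qp_sphere p n k) x \<partial>qp_haar p n) =
       (\<integral>\<^sup>+ x. ennreal ((c * real p powr (real_of_int k * a)) powr s) * indicator (qp_sphere p n k) x \<partial>qp_haar p n)"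
      by (intro nn_integral_cong)
        (auto simp: indicator_def qp_sphere_iff rad a_def[symmetric] powr_powr qp_norm_def)
    also have "\<dots> = ennreal ((c * real p powr (real_of_int k * a)) powr s) *
        ennreal (real p powr (real_of_int k * real n) * sph)"
      by (simp add: nn_integral_cmult_indicator emeasure_sphere)
    finally have "wL_norm_shell p n s (pw p n \<alpha>) f k =
        epow (ennreal (real p powr (real_of_int k * \<alpha>) * ((c * real p powr (real_of_int k * a)) powr s *
          (real p powr (real_of_int k * real n) * sph)))) (1 / s)"
      using sph_pos by (simp add: wL_norm_shell_pw f ennreal_mult'')
    also have "\<dots> = ennreal ((real p powr (real_of_int k * \<alpha>) * ((c * real p powr (real_of_int k * a)) powr s *
          (real p powr (real_of_int k * real n) * sph))) powr (1 / s))"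
      using sph_pos by (intro epow_ennreal) simp
    also have "(real p powr (real_of_int k * \<alpha>) * ((c * real p powr (real_of_int k * a)) powr s *
          (real p powr (real_of_int k * real n) * sph))) powr (1 / s) =
        (real p powr (real_of_int k * \<alpha> / s) * real p powr (real_of_int k * a) * real p powr (real_of_int k * real n / s)) *
        (c * sph powr (1 / s))"
      using sph_pos pos c by (simp add: powr_mult powr_powr)
    also have "real p powr (real_of_int k * \<alpha> / s) * real p powr (real_of_int k * a) * real p powr (real_of_int k * real n / s)
        = real p powr (real_of_int k * (\<mu> - b))"
    proof -
      have "real_of_int k * \<alpha> / s + real_of_int k * a + real_of_int k * real n / s = real_of_int k * (\<mu> - b)"
        using pos by (simp add: a_def field_simps)
      then show ?thesis by (simp only: powr_add[symmetric])
    qed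
    finally show ?thesis by (simp add: mult.commute)
  qed
  define X where "X = c * sph powr (1 / s)"
  have X: "0 \<le> X" using c by (simp add: X_def)
  have geo_sums: "(\<lambda>i. (real p powr (- (\<mu> * l))) ^ i) sums geo (\<mu> * l)"
    unfolding geo_def using p2 pos powr_less_mono[of "- (\<mu> * l)" 0 "real p"]
    by (intro geometric_sums) auto
  have level: "ennreal (real p powr (- real_of_int k0 * \<mu>)) *
      epow (\<Sum>i::nat. ennreal (real p powr (real_of_int (k0 - int i) * b * l)) *
                      epow (wL_norm_shell p n s (pw p n \<alpha>) f (k0 - int i)) l) (1 / l) =
      ennreal (X * geo (\<mu> * l) powr (1 / l))" for k0
  proof -
    have "ennreal (real p powr (real_of_int (k0 - int i) * b * l)) *
        epow (wL_norm_shell p n s (pw p n \<alpha>) f (k0 - int i)) l =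
        ennreal (X powr l * real p powr (real_of_int k0 * \<mu> * l) * (real p powr (- (\<mu> * l))) ^ i)" for i
    proof -
      have "ennreal (real p powr (real_of_int (k0 - int i) * b * l)) *
          epow (wL_norm_shell p n s (pw p n \<alpha>) f (k0 - int i)) l =
          ennreal (real p powr (real_of_int (k0 - int i) * b * l) *
            (X * real p powr (real_of_int (k0 - int i) * (\<mu> - b))) powr l)"
        unfolding wL X_def[symmetric] using X by (subst epow_ennreal) (simp_all add: ennreal_mult'')
      also have "real p powr (real_of_int (k0 - int i) * b * l) *
            (X * real p powr (real_of_int (k0 - int i) * (\<mu> - b))) powr l =
          X powr l * (real p powr (real_of_int (k0 - int i) * b * l) *
            real p powr (real_of_int (k0 - int i) * (\<mu> - b) * l))"
        using X by (simp add: powr_mult powr_powr)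
      also have "real p powr (real_of_int (k0 - int i) * b * l) *
            real p powr (real_of_int (k0 - int i) * (\<mu> - b) * l) =
          real p powr (real_of_int k0 * \<mu> * l) * (real p powr (- (\<mu> * l))) ^ i"
        using p2 by (simp add: powr_powr algebra_simps flip: powr_add powr_realpow[OF P(2)])
      finally show ?thesis by (simp add: mult.assoc)
    qed
    then have "(\<Sum>i::nat. ennreal (real p powr (real_of_int (k0 - int i) * b * l)) *
                      epow (wL_norm_shell p n s (pw p n \<alpha>) f (k0 - int i)) l) =
        (\<Sum>i::nat. ennreal (X powr l * real p powr (real_of_int k0 * \<mu> * l) * (real p powr (- (\<mu> * l))) ^ i))"
      by (rule suminf_cong)
    also have "\<dots> = ennreal (X powr l * real p powr (real_of_int k0 * \<mu> * l) * geo (\<mu> * l))"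
      by (intro suminf_ennreal_eq sums_mult geo_sums) auto
    finally have level_sum: "(\<Sum>i::nat. ennreal (real p powr (real_of_int (k0 - int i) * b * l)) *
                      epow (wL_norm_shell p n s (pw p n \<alpha>) f (k0 - int i)) l) =
        ennreal (X powr l * real p powr (real_of_int k0 * \<mu> * l) * geo (\<mu> * l))" .
    have "ennreal (real p powr (- real_of_int k0 * \<mu>)) *
      epow (\<Sum>i::nat. ennreal (real p powr (real_of_int (k0 - int i) * b * l)) *
                      epow (wL_norm_shell p n s (pw p n \<alpha>) f (k0 - int i)) l) (1 / l) =
      ennreal (real p powr (- real_of_int k0 * \<mu>) *
        (X powr l * real p powr (real_of_int k0 * \<mu> * l) * geo (\<mu> * l)) powr (1 / l))"
      unfolding level_sum using geo_pos[of "\<mu> * l"] pos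
      by (subst epow_ennreal) (simp_all add: ennreal_mult'')
    also have "(X powr l * real p powr (real_of_int k0 * \<mu> * l) * geo (\<mu> * l)) powr (1 / l) =
        X * real p powr (real_of_int k0 * \<mu>) * geo (\<mu> * l) powr (1 / l)"
      using geo_pos[of "\<mu> * l"] pos X by (simp add: powr_mult powr_powr)
    also have "real p powr (- real_of_int k0 * \<mu>) * \<dots> = X * geo (\<mu> * l) powr (1 / l)"
      using p2 by (simp add: powr_minus)
    finally show ?thesis .
  qed
  show ?thesis unfolding MK_norm_def level by (simp add: X_def mult.assoc)
qed

text \<open>Choosing \<open>k0 = k\<close> and keeping one term of the sum isolates S_k. Up to a
  constant, the resulting bound is what the critical power of |x| attains, which is why these powers
  are extremal.\<close>

lemma MK_norm_shell_bound:
  assumes f [measurable]: "f \<in> borel_measurable (qp_mspace p n)"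
    and M: "MK_norm p n b \<mu> l s (pw p n \<alpha>) f = ennreal M" "0 \<le> M"
    and pos: "0 < s" "0 < l"
  shows "(\<integral>\<^sup>+ y. ennreal (cmod (f (qp_dil (- k) y)) powr s) * indicator (qp_sphere p n 0) y \<partial>qp_haar p n)
    \<le> ennreal ((M * real p powr (real_of_int k * (\<mu> - b - (real n + \<alpha>) / s))) powr s)"
proof -
  have P: "real p powr a \<noteq> 0" "0 < real p powr a" for a using p2 by auto
  define J where "J = (\<integral>\<^sup>+ x. ennreal (cmod (f x) powr s) * indicator (qp_sphere p n k) x \<partial>qp_haar p n)"
  have wL: "wL_norm_shell p n s (pw p n \<alpha>) f k = epow (ennreal (real p powr (real_of_int k * \<alpha>)) * J) (1 / s)"
    by (simp add: wL_norm_shell_pw J_def)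
  \<comment> \<open>Spheres are counted downwards from k, so index 0 is S_k itself.\<close>
  define T where "T i = ennreal (real p powr (real_of_int (k - int i) * b * l)) *
                      epow (wL_norm_shell p n s (pw p n \<alpha>) f (k - int i)) l" for i
  have "T 0 \<le> (\<Sum>i. T i)" using sum_le_suminf[of T "{0}"] by simp
  then have "ennreal (real p powr (- real_of_int k * \<mu>)) * epow (T 0) (1 / l) \<le>
      ennreal (real p powr (- real_of_int k * \<mu>)) * epow (\<Sum>i. T i) (1 / l)"
    using pos by (intro mult_left_mono epow_mono) auto
  also have "\<dots> \<le> MK_norm p n b \<mu> l s (pw p n \<alpha>) f"
    unfolding MK_norm_def T_def by (rule SUP_upper) simp
  finally have le: "ennreal (real p powr (- real_of_int k * \<mu>)) * epow (T 0) (1 / l) \<le> ennreal M"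
    using M by simp
  have "J \<noteq> top"
  proof
    assume "J = top"
    then have "T 0 = top" using P by (simp add: T_def wL ennreal_mult_top)
    then show False using le P by (simp add: ennreal_mult_top top_unique)
  qed
  then obtain j where j: "J = ennreal j" "0 \<le> j" by (cases J) auto
  define z where "z = (real p powr (real_of_int k * \<alpha>) * j) powr (1 / s)"
  have "T 0 = ennreal (real p powr (real_of_int k * b * l) * z powr l)"
    using j by (simp add: T_def wL z_def epow_ennreal flip: ennreal_mult'')
  then have "epow (T 0) (1 / l) = ennreal ((real p powr (real_of_int k * b * l) * z powr l) powr (1 / l))"
    by (simp only:) (simp add: epow_ennreal)
  then have "ennreal (real p powr (- real_of_int k * \<mu>)) * epow (T 0) (1 / l) =
      ennreal (real p powr (- real_of_int k * \<mu>) * (real p powr (real_of_int k * b * l) * z powr l) powr (1 / l))"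
    by (simp only: ennreal_mult'' powr_ge_zero)
  also have "(real p powr (real_of_int k * b * l) * z powr l) powr (1 / l) = real p powr (real_of_int k * b) * z"
    using pos by (simp add: powr_mult powr_powr z_def)
  finally have "real p powr (- real_of_int k * \<mu>) * (real p powr (real_of_int k * b) * z) \<le> M"
    using le M by (simp add: ennreal_le_iff)
  then have "real p powr (real_of_int k * (\<mu> - b)) * (real p powr (- real_of_int k * \<mu>) * (real p powr (real_of_int k * b) * z))
      \<le> real p powr (real_of_int k * (\<mu> - b)) * M"
    by (intro mult_left_mono) auto
  also have "real p powr (real_of_int k * (\<mu> - b)) * (real p powr (- real_of_int k * \<mu>) * (real p powr (real_of_int k * b) * z))
     = (real p powr (real_of_int k * (\<mu> - b)) * real p powr (- real_of_int k * \<mu>) * real p powr (real_of_int k * b)) * z"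
    by simp
  also have "real p powr (real_of_int k * (\<mu> - b)) * real p powr (- real_of_int k * \<mu>) * real p powr (real_of_int k * b) = 1"
    using p2 by (simp add: algebra_simps flip: powr_add)
  finally have "z powr s \<le> (M * real p powr (real_of_int k * (\<mu> - b))) powr s"
    using pos by (intro powr_mono2) (auto simp: z_def mult.commute)
  moreover have "z powr s = real p powr (real_of_int k * \<alpha>) * j"
    using pos j by (simp add: z_def powr_powr)
  \<comment> \<open>The factor removes the weight p^(k \<alpha>) and supplies the Jacobian p^(-k n)
    of the passage from S_k to S_0.\<close>
  ultimately have "real p powr (real_of_int k * (- real n - \<alpha>)) * (real p powr (real_of_int k * \<alpha>) * j) \<le>
      real p powr (real_of_int k * (- real n - \<alpha>)) * (M * real p powr (real_of_int k * (\<mu> - b))) powr s"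
    by (intro mult_left_mono) auto
  also have "real p powr (real_of_int k * (- real n - \<alpha>)) * (real p powr (real_of_int k * \<alpha>) * j) =
      real p powr (- real_of_int k * real n) * j"
    by (simp add: algebra_simps flip: powr_add)
  also have "real p powr (real_of_int k * (- real n - \<alpha>)) * (M * real p powr (real_of_int k * (\<mu> - b))) powr s =
      M powr s * (real p powr (real_of_int k * (- real n - \<alpha>)) * real p powr (real_of_int k * (\<mu> - b) * s))"
    using M by (simp add: powr_mult powr_powr)
  also have "real p powr (real_of_int k * (- real n - \<alpha>)) * real p powr (real_of_int k * (\<mu> - b) * s) =
      (real p powr (real_of_int k * (\<mu> - b - (real n + \<alpha>) / s))) powr s"
  proof -
    have "real_of_int k * (- real n - \<alpha>) + real_of_int k * (\<mu> - b) * s =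
        real_of_int k * (\<mu> - b - (real n + \<alpha>) / s) * s"
      using pos by (simp add: field_simps)
    then show ?thesis by (simp only: powr_powr powr_add[symmetric])
  qed
  also have "M powr s * \<dots> = (M * real p powr (real_of_int k * (\<mu> - b - (real n + \<alpha>) / s))) powr s"
    using M by (simp add: powr_mult)
  finally have "ennreal (real p powr (- real_of_int k * real n)) * J \<le>
      ennreal ((M * real p powr (real_of_int k * (\<mu> - b - (real n + \<alpha>) / s))) powr s)"
    using j by (simp add: ennreal_leI flip: ennreal_mult'')
  then show ?thesis
    by (subst nn_integral_sphere_dil) (simp_all add: J_def)
qed

end

section \<open>The rough Hausdorff operator\<close>

locale rough_hausdorff = padic_space p n for p n :: nat +
  fixes m :: nat and q \<alpha> \<beta> l lam :: "nat \<Rightarrow> real" and \<Omega> :: "qpn \<Rightarrow> complex"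
  assumes m1: "1 \<le> m" and q1: "\<And>i. i < m \<Longrightarrow> 1 \<le> q i" and l1: "\<And>i. i < m \<Longrightarrow> 1 \<le> l i"
    and lam0: "\<And>i. i < m \<Longrightarrow> 0 < lam i"
    and \<Omega>_measurable: "\<Omega> \<in> borel_measurable (restrict_space (qp_haar p n) (qp_sphere p n 0))"
    and \<Omega>_nonzero: "AE y in qp_haar p n. y \<in> qp_sphere p n 0 \<longrightarrow> \<Omega> y \<noteq> 0"
    and \<Omega>_Lp: "Lp_on (qp_haar p n) (qp_sphere p n 0) (conj_exp (1 / (\<Sum>i<m. 1 / q i))) \<Omega>"
begin

definition Q where "Q = 1 / (\<Sum>i<m. 1 / q i)"
definition A where "A = Q * (\<Sum>i<m. \<alpha> i / q i)"
definition B where "B = (\<Sum>i<m. \<beta> i)"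
definition L where "L = 1 / (\<Sum>i<m. 1 / l i)"
definition Lam where "Lam = (\<Sum>i<m. lam i)"
definition W where "W = (LINT y : qp_sphere p n 0 | qp_haar p n. cmod (\<Omega> y))"

text \<open>The function \<open>|x|\<close> to the power \<open>crit i\<close> is the extremal one for the \<open>i\<close>-th Morrey-Herz space.\<close>
definition crit :: "nat \<Rightarrow> real" where
  "crit i = lam i - \<beta> i - (real n + \<alpha> i) / q i"

text \<open>The summands of C5 as real numbers; the exponent of p^\<gamma> is 1 plus the sum of the
  \<open>crit i\<close>.\<close>

definition weight :: "(qp1 \<Rightarrow> real) \<Rightarrow> int \<Rightarrow> real" where
  "weight \<Phi> \<gamma> = \<Phi> (qp_pow \<gamma>) / real p powr (real_of_int \<gamma> * (1 - B - (real n + A) / Q + Lam))"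

abbreviation bounded_by :: "(qp1 \<Rightarrow> real) \<Rightarrow> real \<Rightarrow> bool" where
  "bounded_by \<Phi> C \<equiv> H_bound p n m \<Phi> \<Omega> \<beta> lam l q (\<lambda>i. pw p n (\<alpha> i)) B Lam L Q (pw p n A) C"

lemma inv_sum_pos: "0 < (\<Sum>i<m. 1 / q i)" "0 < (\<Sum>i<m. 1 / l i)"
proof -
  have "{..<m} \<noteq> {}" using m1 by (auto simp: lessThan_empty_iff)
  then show "0 < (\<Sum>i<m. 1 / q i)" "0 < (\<Sum>i<m. 1 / l i)"
    using less_le_trans[OF zero_less_one q1] less_le_trans[OF zero_less_one l1] by (auto intro!: sum_pos)
qed

lemma exponents_pos: "0 < Q" "0 < L" "0 < Lam"
proof -
  have "{..<m} \<noteq> {}" using m1 by (auto simp: lessThan_empty_iff)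
  then show "0 < Q" "0 < L" "0 < Lam"
    using inv_sum_pos lam0 by (auto simp: Q_def L_def Lam_def intro!: sum_pos)
qed

text \<open>Ensures that the product of the critical input powers is the critical power of the
  target space.\<close>

lemma sum_crit: "(\<Sum>i<m. crit i) = Lam - B - (real n + A) / Q"
proof -
  have "(real n + A) / Q = real n * (\<Sum>i<m. 1 / q i) + (\<Sum>i<m. \<alpha> i / q i)"
    using inv_sum_pos by (simp add: A_def Q_def field_simps)
  also have "\<dots> = (\<Sum>i<m. (real n + \<alpha> i) / q i)"
    by (simp add: sum_distrib_left sum.distrib add_divide_distrib)
  finally show ?thesis
    by (simp add: crit_def Lam_def B_def sum_subtractf)
qed

lemma prod_powr_crit: "0 < c \<Longrightarrow> (\<Prod>i<m. c powr crit i) = c powr (Lam - B - (real n + A) / Q)"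
  by (simp add: powr_sum flip: sum_crit)

text \<open>For y on the unit sphere the scaled argument has norm p^(-\<gamma>) |x|. The power of
  p^(-\<gamma>) joins \<Phi> to form a summand of C5, and the power of |x| leaves the sum.\<close>

lemma weight_eq:
  assumes "x \<noteq> qp_zero"
  shows "\<Phi> (qp_pow \<gamma>) / real p powr real_of_int \<gamma> *
      (real p powr (- real_of_int (\<gamma> + qp_ord n x))) powr (Lam - B - (real n + A) / Q) =
    weight \<Phi> \<gamma> * qp_norm p n x powr (Lam - B - (real n + A) / Q)"
proof -
  define a where "a = Lam - B - (real n + A) / Q"
  have pow: "(real p powr (- real_of_int (\<gamma> + qp_ord n x))) powr a =
      real p powr (- (real_of_int \<gamma> * a)) * qp_norm p n x powr a"
    using assms by (simp add: qp_norm_def powr_powr algebra_simps flip: powr_add)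
  have wt: "weight \<Phi> \<gamma> = \<Phi> (qp_pow \<gamma>) / (real p powr real_of_int \<gamma> * real p powr (real_of_int \<gamma> * a))"
    by (simp add: weight_def a_def algebra_simps flip: powr_add)
  show ?thesis
    unfolding a_def[symmetric] pow wt by (simp add: powr_minus divide_inverse mult_ac)
qed

text \<open>\<Omega> is measurable only on the unit sphere. Its extension by zero is measurable on
  the whole space and can be composed with dilations.\<close>

definition \<Omega>0 :: "qpn \<Rightarrow> complex" where
  "\<Omega>0 y = (if y \<in> qp_sphere p n 0 then \<Omega> y else 0)"

lemma \<Omega>0_measurable [measurable]: "\<Omega>0 \<in> borel_measurable (qp_mspace p n)"
proof -
  have "qp_sphere p n 0 \<inter> space (qp_haar p n) \<in> sets (qp_haar p n)"
    by (rule sets.Int_space_eq2[THEN ssubst]) simp_all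
  then have "\<Omega>0 \<in> borel_measurable (qp_haar p n)"
    using \<Omega>_measurable unfolding \<Omega>0_def
    by (subst (asm) measurable_restrict_space_iff[where c = 0]) auto
  then show ?thesis by simp
qed

section \<open>Estimates from above\<close>

lemma H_term_bound:
  assumes f [measurable]: "\<And>i. i < m \<Longrightarrow> f i \<in> borel_measurable (qp_mspace p n)"
    and \<Phi>: "\<And>t. 0 \<le> \<Phi> t" and C: "0 \<le> C"
    and le: "(\<integral>\<^sup>+ y. ennreal (cmod (\<Omega> y) * (\<Prod>i<m. cmod (f i (qp_dil (\<gamma> + qp_ord n x) y)))) *
        indicator (qp_sphere p n 0) y \<partial>qp_haar p n) \<le> ennreal C"
  shows "set_integrable (qp_haar p n) (qp_sphere p n 0) (H_integrand p n m \<Phi> \<Omega> f x \<gamma>)"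
    and "cmod (H_term p n m \<Phi> \<Omega> f x \<gamma>) \<le> \<Phi> (qp_pow \<gamma>) / real p powr real_of_int \<gamma> * C"
proof -
  define c where "c = \<Phi> (qp_pow \<gamma>) / real p powr real_of_int \<gamma>"
  have c0: "0 \<le> c" using \<Phi> by (simp add: c_def)
  define F where "F y = \<Omega>0 y * (\<Prod>i<m. f i (qp_dil (\<gamma> + qp_ord n x) y))" for y
  have F [measurable]: "F \<in> borel_measurable (qp_haar p n)"
    unfolding F_def[abs_def] by measurable
  let ?h = "\<lambda>y. indicator (qp_sphere p n 0) y *\<^sub>R H_integrand p n m \<Phi> \<Omega> f x \<gamma> y"
  have h: "?h = (\<lambda>y. complex_of_real c * F y)"
    by (auto simp: fun_eq_iff \<Omega>0_def F_def c_def H_integrand_def qp_scale_def indicator_def)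
  have "(\<integral>\<^sup>+ y. ennreal (cmod (F y)) \<partial>qp_haar p n) \<le> ennreal C"
  proof -
    have "ennreal (cmod (\<Omega> y) * (\<Prod>i<m. cmod (f i (qp_dil (\<gamma> + qp_ord n x) y)))) *
        indicator (qp_sphere p n 0) y = ennreal (cmod (F y))" for y
      by (simp add: F_def \<Omega>0_def norm_mult prod_norm)
    then show ?thesis using le by simp
  qed
  then have "ennreal c * (\<integral>\<^sup>+ y. ennreal (cmod (F y)) \<partial>qp_haar p n) \<le> ennreal c * ennreal C"
    by (rule mult_left_mono) simp
  also have "ennreal c * (\<integral>\<^sup>+ y. ennreal (cmod (F y)) \<partial>qp_haar p n) = (\<integral>\<^sup>+ y. ennreal c * ennreal (cmod (F y)) \<partial>qp_haar p n)"
    by (rule nn_integral_cmult[symmetric]) measurable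
  also have "\<dots> = (\<integral>\<^sup>+ y. ennreal (cmod (?h y)) \<partial>qp_haar p n)"
  proof -
    have "cmod (?h y) = c * cmod (F y)" for y
      using fun_cong[OF h, of y] c0 by (simp only: norm_mult) simp
    then show ?thesis by (simp only: ennreal_mult'' norm_ge_zero)
  qed
  finally have bd: "(\<integral>\<^sup>+ y. ennreal (cmod (?h y)) \<partial>qp_haar p n) \<le> ennreal (c * C)"
    using C by (simp add: ennreal_mult'')
  have meas: "?h \<in> borel_measurable (qp_haar p n)"
    unfolding h by measurable
  have int: "integrable (qp_haar p n) ?h"
    using meas le_less_trans[OF bd ennreal_less_top] by (intro integrableI_bounded) auto
  then show "set_integrable (qp_haar p n) (qp_sphere p n 0) (H_integrand p n m \<Phi> \<Omega> f x \<gamma>)"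
    by (simp add: set_integrable_def)
  have "ennreal (cmod (H_term p n m \<Phi> \<Omega> f x \<gamma>)) \<le> ennreal (c * C)"
    using integral_norm_bound_ennreal[OF int] bd
    by (simp add: H_term_def set_lebesgue_integral_def)
  moreover have "0 \<le> c * C" using C c0 by simp
  ultimately show "cmod (H_term p n m \<Phi> \<Omega> f x \<gamma>) \<le> \<Phi> (qp_pow \<gamma>) / real p powr real_of_int \<gamma> * C"
    by (simp add: c_def)
qed

text \<open>The operator factors through the integer-valued \<open>qp_ord\<close>, and every
  function on a count space is measurable.\<close>

lemma H_op_measurable [measurable]: "H_op p n m \<Phi> \<Omega> f \<in> borel_measurable (qp_mspace p n)"
proof -
  define G where "G e = (\<Sum>\<^sub>\<infinity>\<gamma>. LINT y : qp_sphere p n 0 | qp_haar p n.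
     complex_of_real (\<Phi> (qp_pow \<gamma>) / real p powr real_of_int \<gamma>) * \<Omega> y *
     (\<Prod>i<m. f i (qp_dil (\<gamma> + e) y)))" for e
  have "H_op p n m \<Phi> \<Omega> f = (\<lambda>x. G (qp_ord n x))"
    by (simp add: fun_eq_iff H_op_def H_term_def H_integrand_def[abs_def] G_def qp_scale_def)
  also have "\<dots> \<in> borel_measurable (qp_mspace p n)"
    by (rule measurable_compose[OF measurable_qp_ord]) simp
  finally show ?thesis .
qed

text \<open>The target norm of the critical power of |x|, by \<open>MK_norm_radial\<close>.\<close>

definition radial_const :: real where
  "radial_const = sph powr (1 / Q) * geo (Lam * L) powr (1 / L)"

lemma radial_const_pos: "0 < radial_const"
  using sph_pos geo_pos[of "Lam * L"] exponents_pos by (simp add: radial_const_def)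

lemma upper_bound:
  obtains c where "0 < c"
    "\<And>\<Phi>. (\<And>t. 0 \<le> \<Phi> t) \<Longrightarrow> weight \<Phi> summable_on UNIV \<Longrightarrow> bounded_by \<Phi> (c * infsum (weight \<Phi>) UNIV)"
proof (rule Lp_on_conj_exp_holder)
  show "qp_sphere p n 0 \<in> sets (qp_haar p n)" by simp
  show "1 \<le> m" "\<forall>i<m. 1 \<le> q i" using m1 q1 by auto
  show "Lp_on (qp_haar p n) (qp_sphere p n 0) (conj_exp (1 / (\<Sum>i<m. 1 / q i))) \<Omega>" by (rule \<Omega>_Lp)
next
  fix K assume K0: "0 < K" and K:
    "\<And>F N. (\<And>i. i < m \<Longrightarrow> F i \<in> borel_measurable (qp_haar p n)) \<Longrightarrow> (\<And>i. i < m \<Longrightarrow> 0 \<le> N i) \<Longrightarrow>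
       (\<And>i. i < m \<Longrightarrow> (\<integral>\<^sup>+ y. ennreal (cmod (F i y) powr q i) * indicator (qp_sphere p n 0) y \<partial>qp_haar p n) \<le> ennreal (N i)) \<Longrightarrow>
       (\<integral>\<^sup>+ y. ennreal (cmod (\<Omega> y) * (\<Prod>i<m. cmod (F i y))) * indicator (qp_sphere p n 0) y \<partial>qp_haar p n)
         \<le> ennreal (K * (\<Prod>i<m. N i powr (1 / q i)))"
  show thesis
  proof (rule that[of "K * radial_const"])
    show "0 < K * radial_const" using K0 radial_const_pos by simp
    fix \<Phi> :: "qp1 \<Rightarrow> real" assume \<Phi>: "\<And>t. 0 \<le> \<Phi> t" and sm: "weight \<Phi> summable_on UNIV"
    have w0: "0 \<le> weight \<Phi> \<gamma>" for \<gamma> using \<Phi> by (simp add: weight_def)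
    show "bounded_by \<Phi> (K * radial_const * infsum (weight \<Phi>) UNIV)"
      unfolding H_bound_def
    proof (intro allI impI)
      fix f assume f: "\<forall>i<m. f i \<in> MK_space p n (\<beta> i) (lam i) (l i) (q i) (pw p n (\<alpha> i))"
      have fm: "f i \<in> borel_measurable (qp_mspace p n)" if "i < m" for i
        using f that by (auto simp: MK_space_def)
      define M where "M i = enn2real (MK_norm p n (\<beta> i) (lam i) (l i) (q i) (pw p n (\<alpha> i)) (f i))" for i
      have M: "MK_norm p n (\<beta> i) (lam i) (l i) (q i) (pw p n (\<alpha> i)) (f i) = ennreal (M i)" if "i < m" for i
        using f that by (auto simp: MK_space_def M_def less_top)
      have M0: "0 \<le> M i" for i by (simp add: M_def)
      let ?a = "Lam - B - (real n + A) / Q"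
      have term_le: "set_integrable (qp_haar p n) (qp_sphere p n 0) (H_integrand p n m \<Phi> \<Omega> f x \<gamma>) \<and>
          cmod (H_term p n m \<Phi> \<Omega> f x \<gamma>) \<le> K * (\<Prod>i<m. M i) * qp_norm p n x powr ?a * weight \<Phi> \<gamma>"
        if x: "x \<in> qp_space p n" "x \<noteq> qp_zero" for x \<gamma>
      proof -
        \<comment> \<open>As y runs through S_0, the scaled argument runs through S_k for this k, so
          the bound on a single sphere applies to each factor.\<close>
        let ?k = "- (\<gamma> + qp_ord n x)"
        let ?C = "K * (\<Prod>i<m. M i * (real p powr real_of_int ?k) powr crit i)"
        have "(\<integral>\<^sup>+ y. ennreal (cmod (\<Omega> y) * (\<Prod>i<m. cmod (f i (qp_dil (- ?k) y)))) *
            indicator (qp_sphere p n 0) y \<partial>qp_haar p n)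
          \<le> ennreal (K * (\<Prod>i<m. ((M i * real p powr (real_of_int ?k * crit i)) powr q i) powr (1 / q i)))"
        proof (rule K)
          fix i assume i: "i < m"
          show "(\<lambda>y. f i (qp_dil (- ?k) y)) \<in> borel_measurable (qp_haar p n)"
            using fm[OF i] by measurable
          show "(\<integral>\<^sup>+ y. ennreal (cmod (f i (qp_dil (- ?k) y)) powr q i) * indicator (qp_sphere p n 0) y \<partial>qp_haar p n)
            \<le> ennreal ((M i * real p powr (real_of_int ?k * crit i)) powr q i)"
            unfolding crit_def
            using fm[OF i] M[OF i] M0 q1[OF i] l1[OF i] by (intro MK_norm_shell_bound) auto
        qed simp
        also have "(\<Prod>i<m. ((M i * real p powr (real_of_int ?k * crit i)) powr q i) powr (1 / q i)) =
            (\<Prod>i<m. M i * (real p powr real_of_int ?k) powr crit i)"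
        proof (rule prod.cong)
          fix i assume "i \<in> {..<m}"
          then have "q i \<noteq> 0" using q1[of i] by auto
          then show "((M i * real p powr (real_of_int ?k * crit i)) powr q i) powr (1 / q i) =
              M i * (real p powr real_of_int ?k) powr crit i"
            using M0[of i] by (simp add: powr_powr)
        qed simp
        finally have le: "(\<integral>\<^sup>+ y. ennreal (cmod (\<Omega> y) * (\<Prod>i<m. cmod (f i (qp_dil (\<gamma> + qp_ord n x) y)))) *
            indicator (qp_sphere p n 0) y \<partial>qp_haar p n) \<le> ennreal ?C"
          by (simp only: minus_minus)
        have C0: "0 \<le> ?C" using K0 M0 by (intro mult_nonneg_nonneg prod_nonneg) auto
        have C: "\<Phi> (qp_pow \<gamma>) / real p powr real_of_int \<gamma> * ?C = K * (\<Prod>i<m. M i) * qp_norm p n x powr ?a * weight \<Phi> \<gamma>"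
        proof -
          have C_eq: "?C = K * (\<Prod>i<m. M i) * (real p powr (- real_of_int (\<gamma> + qp_ord n x))) powr ?a"
            using p2 by (simp only: prod.distrib, subst prod_powr_crit) auto
          have "\<Phi> (qp_pow \<gamma>) / real p powr real_of_int \<gamma> * ?C = K * (\<Prod>i<m. M i) *
              (\<Phi> (qp_pow \<gamma>) / real p powr real_of_int \<gamma> * (real p powr (- real_of_int (\<gamma> + qp_ord n x))) powr ?a)"
            unfolding C_eq by (rule mult.left_commute)
          also note weight_eq[OF x(2)]
          finally show ?thesis by (simp only: mult.assoc mult.commute[of "weight \<Phi> \<gamma>"])
        qed
        show ?thesis
          using H_term_bound[of f \<Phi> ?C \<gamma> x, OF fm \<Phi> C0 le] unfolding C by simp
      qed
      have summ: "H_term p n m \<Phi> \<Omega> f x summable_on UNIV"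
        and op_le: "cmod (H_op p n m \<Phi> \<Omega> f x) \<le>
          K * (\<Prod>i<m. M i) * infsum (weight \<Phi>) UNIV * qp_norm p n x powr ?a"
        if x: "x \<in> qp_space p n" "x \<noteq> qp_zero" for x
      proof -
        let ?D = "K * (\<Prod>i<m. M i) * qp_norm p n x powr ?a"
        have sD: "(\<lambda>\<gamma>. ?D * weight \<Phi> \<gamma>) summable_on UNIV"
          using sm by (rule summable_on_cmult_right)
        have ab: "(\<lambda>\<gamma>. cmod (H_term p n m \<Phi> \<Omega> f x \<gamma>)) summable_on UNIV"
          using sD by (rule summable_on_comparison_test) (use term_le[OF x] in auto)
        then show "H_term p n m \<Phi> \<Omega> f x summable_on UNIV" by (rule abs_summable_summable)
        have "cmod (H_op p n m \<Phi> \<Omega> f x) \<le> (\<Sum>\<^sub>\<infinity>\<gamma>. cmod (H_term p n m \<Phi> \<Omega> f x \<gamma>))"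
          unfolding H_op_def using ab by (rule norm_infsum_bound)
        also have "\<dots> \<le> (\<Sum>\<^sub>\<infinity>\<gamma>. ?D * weight \<Phi> \<gamma>)"
          using ab sD term_le[OF x] by (intro infsum_mono) auto
        also have "\<dots> = ?D * infsum (weight \<Phi>) UNIV"
          using sm by (intro infsum_cmult_right) auto
        finally show "cmod (H_op p n m \<Phi> \<Omega> f x) \<le>
          K * (\<Prod>i<m. M i) * infsum (weight \<Phi>) UNIV * qp_norm p n x powr ?a"
          by (simp add: mult_ac)
      qed
      have I0: "0 \<le> infsum (weight \<Phi>) UNIV" using w0 by (intro infsum_nonneg) auto
      define c where "c = K * (\<Prod>i<m. M i) * infsum (weight \<Phi>) UNIV"
      have c0: "0 \<le> c" using K0 M0 I0 by (auto simp: c_def intro!: mult_nonneg_nonneg prod_nonneg)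
      \<comment> \<open>A radial majorant with the critical exponent of the target, hence with
        exactly known norm.\<close>
      define g where "g x = complex_of_real (c * qp_norm p n x powr ?a)" for x
      have gm: "g \<in> borel_measurable (qp_mspace p n)" unfolding g_def[abs_def] by measurable
      have "MK_norm p n B Lam L Q (pw p n A) (H_op p n m \<Phi> \<Omega> f) \<le> MK_norm p n B Lam L Q (pw p n A) g"
        using op_le[folded c_def] c0 exponents_pos
        by (intro MK_norm_mono) (auto simp: g_def simp del: of_real_mult)
      also have "\<dots> = ennreal (c * radial_const)"
        unfolding radial_const_def
        using gm c0 exponents_pos by (intro MK_norm_radial) (auto simp: g_def norm_mult)
      also have "c * radial_const = K * radial_const * infsum (weight \<Phi>) UNIV * (\<Prod>i<m. M i)"
        by (simp add: c_def)
      also have "ennreal \<dots> = ennreal (K * radial_const * infsum (weight \<Phi>) UNIV) * ennreal (\<Prod>i<m. M i)"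
        using M0 by (intro ennreal_mult'' prod_nonneg) auto
      also have "ennreal (\<Prod>i<m. M i) = (\<Prod>i<m. ennreal (M i))"
        using M0 by (intro prod_ennreal[symmetric])
      also have "\<dots> = (\<Prod>i<m. MK_norm p n (\<beta> i) (lam i) (l i) (q i) (pw p n (\<alpha> i)) (f i))"
        using M by (intro prod.cong) auto
      finally have le: "MK_norm p n B Lam L Q (pw p n A) (H_op p n m \<Phi> \<Omega> f) \<le>
        ennreal (K * radial_const * infsum (weight \<Phi>) UNIV) *
          (\<Prod>i<m. MK_norm p n (\<beta> i) (lam i) (l i) (q i) (pw p n (\<alpha> i)) (f i))" .
      also have "\<dots> = ennreal (K * radial_const * infsum (weight \<Phi>) UNIV) * (\<Prod>i<m. ennreal (M i))"
        using M by simp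
      also have "\<dots> < \<infinity>" using M0 by (simp add: prod_ennreal ennreal_mult_less_top)
      finally have fin: "MK_norm p n B Lam L Q (pw p n A) (H_op p n m \<Phi> \<Omega> f) < \<infinity>" .
      show "(\<forall>x\<in>qp_space p n. x \<noteq> qp_zero \<longrightarrow> H_defined p n m \<Phi> \<Omega> f x) \<and>
        H_op p n m \<Phi> \<Omega> f \<in> MK_space p n B Lam L Q (pw p n A) \<and>
        MK_norm p n B Lam L Q (pw p n A) (H_op p n m \<Phi> \<Omega> f) \<le>
        ennreal (K * radial_const * infsum (weight \<Phi>) UNIV) *
          (\<Prod>i<m. MK_norm p n (\<beta> i) (lam i) (l i) (q i) (pw p n (\<alpha> i)) (f i))"
        using term_le summ le fin by (auto simp: H_defined_def MK_space_def)
    qed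
  qed
qed

section \<open>Extremal functions and estimates from below\<close>

lemma \<Omega>_integral:
  shows \<Omega>_integrable: "set_integrable (qp_haar p n) (qp_sphere p n 0) (\<lambda>y. cmod (\<Omega> y))"
    and W_pos: "0 < W"
proof -
  have fin: "(\<integral>\<^sup>+ y. ennreal (cmod (\<Omega>0 y)) \<partial>qp_haar p n) < \<infinity>"
  proof (rule Lp_on_conj_exp_holder)
    show "qp_sphere p n 0 \<in> sets (qp_haar p n)" by simp
    show "1 \<le> m" "\<forall>i<m. 1 \<le> q i" using m1 q1 by auto
    show "Lp_on (qp_haar p n) (qp_sphere p n 0) (conj_exp (1 / (\<Sum>i<m. 1 / q i))) \<Omega>" by (rule \<Omega>_Lp)
  next
    fix K assume K:
      "\<And>F N. (\<And>i. i < m \<Longrightarrow> F i \<in> borel_measurable (qp_haar p n)) \<Longrightarrow> (\<And>i. i < m \<Longrightarrow> 0 \<le> N i) \<Longrightarrow>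
         (\<And>i. i < m \<Longrightarrow> (\<integral>\<^sup>+ y. ennreal (cmod (F i y) powr q i) * indicator (qp_sphere p n 0) y \<partial>qp_haar p n) \<le> ennreal (N i)) \<Longrightarrow>
         (\<integral>\<^sup>+ y. ennreal (cmod (\<Omega> y) * (\<Prod>i<m. cmod (F i y))) * indicator (qp_sphere p n 0) y \<partial>qp_haar p n)
           \<le> ennreal (K * (\<Prod>i<m. N i powr (1 / q i)))"
    \<comment> \<open>Constant factors 1 are admissible because S_0 has finite measure, so Hoelder's
      inequality gives integrability of \<Omega> itself.\<close>
    have "(\<integral>\<^sup>+ y. ennreal (cmod (\<Omega> y) * (\<Prod>i<m. cmod (1::complex))) * indicator (qp_sphere p n 0) y \<partial>qp_haar p n)
           \<le> ennreal (K * (\<Prod>i<m. sph powr (1 / q i)))"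
      using sph_pos by (intro K[of "\<lambda>_ _. 1" "\<lambda>_. sph"]) (simp_all add: emeasure_sphere_0)
    moreover have "ennreal (cmod (\<Omega> y) * (\<Prod>i<m. cmod (1::complex))) * indicator (qp_sphere p n 0) y = ennreal (cmod (\<Omega>0 y))" for y
      by (simp add: \<Omega>0_def)
    ultimately have "(\<integral>\<^sup>+ y. ennreal (cmod (\<Omega>0 y)) \<partial>qp_haar p n) \<le> ennreal (K * (\<Prod>i<m. sph powr (1 / q i)))"
      by (simp only:)
    then show ?thesis by (simp add: le_less_trans[OF _ ennreal_less_top])
  qed
  have ind: "(\<lambda>y. indicator (qp_sphere p n 0) y *\<^sub>R cmod (\<Omega> y)) = (\<lambda>y. cmod (\<Omega>0 y))"
    by (auto simp: fun_eq_iff \<Omega>0_def indicator_def)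
  have int: "integrable (qp_haar p n) (\<lambda>y. cmod (\<Omega>0 y))"
    using fin by (intro integrableI_bounded) (auto)
  then show "set_integrable (qp_haar p n) (qp_sphere p n 0) (\<lambda>y. cmod (\<Omega> y))"
    unfolding set_integrable_def ind .
  have W: "(\<integral>\<^sup>+ y. ennreal (cmod (\<Omega>0 y)) \<partial>qp_haar p n) = ennreal W"
    unfolding W_def set_lebesgue_integral_def ind by (rule nn_integral_eq_integral[OF int]) simp
  have "W \<noteq> 0"
  proof
    assume "W = 0"
    then have "(\<integral>\<^sup>+ y. ennreal (cmod (\<Omega>0 y)) \<partial>qp_haar p n) = 0" unfolding W by simp
    then have "AE y in qp_haar p n. ennreal (cmod (\<Omega>0 y)) = 0"
      by (rule nn_integral_0_iff_AE[THEN iffD1, rotated]) measurable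
    with \<Omega>_nonzero have "AE y in qp_haar p n. y \<notin> qp_sphere p n 0"
    proof eventually_elim
      case (elim y)
      then show ?case by (cases "y \<in> qp_sphere p n 0") (simp_all add: \<Omega>0_def)
    qed
    then have "emeasure (qp_haar p n) {y \<in> space (qp_haar p n). y \<in> qp_sphere p n 0} = 0"
      by (rule emeasure_eq_0_AE)
    also have "{y \<in> space (qp_haar p n). y \<in> qp_sphere p n 0} = qp_sphere p n 0"
      by (auto simp: qp_sphere_def)
    finally have "emeasure (qp_haar p n) (qp_sphere p n 0) = 0" .
    then show False using sph_pos by (simp add: emeasure_sphere_0)
  qed
  moreover have "0 \<le> W" unfolding W_def set_lebesgue_integral_def ind by simp
  ultimately show "0 < W" by simp
qed

text \<open>The phase of the first factor cancels that of \<open>\<Omega>\<close>, since \<open>qp_dil (- qp_ord n x) x\<close> is \<open>|x| x\<close>.\<close>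
definition extremal :: "nat \<Rightarrow> qpn \<Rightarrow> complex" where
  "extremal i x = complex_of_real (qp_norm p n x powr crit i) *
     (if i = 0 then cnj (sgn (\<Omega>0 (qp_dil (- qp_ord n x) x))) else 1)"

definition extremal_const :: "nat \<Rightarrow> real" where
  "extremal_const i = sph powr (1 / q i) * geo (lam i * l i) powr (1 / l i)"

lemma extremal_const_pos: "i < m \<Longrightarrow> 0 < extremal_const i"
  using sph_pos geo_pos[of "lam i * l i"] lam0[of i] l1[of i] by (simp add: extremal_const_def)

text \<open>The amount of the dilation varies with x, but through the countably many values of
  \<open>qp_ord\<close>, so measurability can be checked for each fixed dilation.\<close>

lemma extremal_measurable: "extremal i \<in> borel_measurable (qp_mspace p n)"
proof -
  have [measurable]: "(\<lambda>x. \<Omega>0 (qp_dil (- qp_ord n x) x)) \<in> borel_measurable (qp_mspace p n)"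
    by (rule measurable_compose_countable[where f = "\<lambda>e x. \<Omega>0 (qp_dil (- e) x)", OF _ measurable_qp_ord])
      measurable
  have [measurable]: "sgn \<in> borel_measurable (borel :: complex measure)"
    unfolding sgn_div_norm[abs_def] by measurable
  have [measurable]: "cnj \<in> borel_measurable borel"
    by (intro borel_measurable_continuous_onI continuous_intros)
  show ?thesis
    unfolding extremal_def[abs_def] by (cases "i = 0") simp_all
qed

text \<open>An inequality, since the phase has modulus 0 where \<Omega> vanishes; comparison with
  the pure power avoids an argument about null sets.\<close>

lemma extremal_MK:
  assumes "i < m"
  shows "MK_norm p n (\<beta> i) (lam i) (l i) (q i) (pw p n (\<alpha> i)) (extremal i) \<le> ennreal (extremal_const i)"
proof -
  let ?g = "\<lambda>x. complex_of_real (qp_norm p n x powr crit i)"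
  have le: "cmod (extremal i x) \<le> cmod (?g x)" for x
    by (simp add: extremal_def norm_mult norm_sgn)
  have "MK_norm p n (\<beta> i) (lam i) (l i) (q i) (pw p n (\<alpha> i)) (extremal i)
      \<le> MK_norm p n (\<beta> i) (lam i) (l i) (q i) (pw p n (\<alpha> i)) ?g"
    using le q1[OF assms] l1[OF assms] by (intro MK_norm_mono) auto
  also have "\<dots> = ennreal (1 * extremal_const i)"
    unfolding extremal_const_def
    using q1[OF assms] l1[OF assms] lam0[OF assms] by (intro MK_norm_radial) (auto simp: crit_def)
  finally show ?thesis by simp
qed

lemma H_term_extremal:
  assumes x: "x \<in> qp_space p n" "x \<noteq> qp_zero"
  shows "H_term p n m \<Phi> \<Omega> extremal x \<gamma> =
    complex_of_real (W * qp_norm p n x powr (Lam - B - (real n + A) / Q) * weight \<Phi> \<gamma>)"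
proof -
  let ?e = "\<gamma> + qp_ord n x"
  let ?z = "(real p powr (- real_of_int ?e)) powr (Lam - B - (real n + A) / Q)"
  let ?c = "\<Phi> (qp_pow \<gamma>) / real p powr real_of_int \<gamma>"
  have integrand: "H_integrand p n m \<Phi> \<Omega> extremal x \<gamma> y = complex_of_real (?c * ?z) * complex_of_real (cmod (\<Omega> y))"
    if y: "y \<in> qp_sphere p n 0" for y
  proof -
    have y': "y \<in> qp_space p n" "y \<noteq> qp_zero" "qp_ord n y = 0" using y by (auto simp: qp_sphere_iff)
    have ord: "qp_ord n (qp_dil ?e y) = ?e" using y' by (simp add: qp_ord_dil)
    have norm: "qp_norm p n (qp_dil ?e y) = real p powr (- real_of_int ?e)"
      using y' ord by (simp add: qp_norm_def)
    \<comment> \<open>The normalisation inside \<open>extremal\<close> undoes the dilation, so the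
      phase is that of \<Omega> at y, whatever \<gamma> and x are.\<close>
    have ext: "extremal i (qp_dil ?e y) = complex_of_real ((real p powr (- real_of_int ?e)) powr crit i) *
        (if i = 0 then cnj (sgn (\<Omega> y)) else 1)" for i
      unfolding extremal_def norm ord qp_dil_dil using y by (simp add: \<Omega>0_def)
    have "(\<Prod>i<m. extremal i (qp_dil ?e y)) =
        complex_of_real (\<Prod>i<m. (real p powr (- real_of_int ?e)) powr crit i) * (\<Prod>i<m. if i = 0 then cnj (sgn (\<Omega> y)) else 1)"
      unfolding ext prod.distrib by simp
    also have "(\<Prod>i<m. (real p powr (- real_of_int ?e)) powr crit i) = ?z"
      using p2 by (intro prod_powr_crit) simp
    \<comment> \<open>Index 0 occurs because m \<ge> 1, so the phase enters exactly once.\<close>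
    also have "(\<Prod>i<m. if i = 0 then cnj (sgn (\<Omega> y)) else 1) = cnj (sgn (\<Omega> y))"
      using m1 by (subst prod.delta) auto
    finally have "H_integrand p n m \<Phi> \<Omega> extremal x \<gamma> y = complex_of_real (?c * ?z) * (\<Omega> y * cnj (sgn (\<Omega> y)))"
      by (simp add: H_integrand_def qp_scale_def)
    also have "\<Omega> y * cnj (sgn (\<Omega> y)) = complex_of_real (cmod (\<Omega> y))"
      by (cases "\<Omega> y = 0") (simp_all add: sgn_div_norm scaleR_conv_of_real complex_norm_square[symmetric] power2_eq_square field_simps)
    finally show ?thesis .
  qed
  have "H_term p n m \<Phi> \<Omega> extremal x \<gamma> =
      (LINT y : qp_sphere p n 0 | qp_haar p n. complex_of_real (?c * ?z) * complex_of_real (cmod (\<Omega> y)))"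
    unfolding H_term_def by (rule set_lebesgue_integral_cong) (auto simp: integrand)
  also have "\<dots> = complex_of_real (?c * ?z) * complex_of_real W"
    by (simp add: W_def set_integral_complex_of_real)
  also have "?c * ?z = weight \<Phi> \<gamma> * qp_norm p n x powr (Lam - B - (real n + A) / Q)"
    by (rule weight_eq[OF x(2)])
  finally show ?thesis by (simp add: mult_ac)
qed

lemma nonzero_point: obtains x where "x \<in> qp_space p n" "x \<noteq> qp_zero"
proof -
  have "qp_sphere p n 0 \<noteq> {}"
    using emeasure_sphere_0 sph_pos by (metis emeasure_empty ennreal_eq_0_iff not_le)
  then show thesis using that by (auto simp: qp_sphere_iff)
qed

text \<open>Boundedness includes convergence of the defining series at every nonzero point. For the
  extremal functions its terms are a positive multiple of \<open>weight\<close>, so a single point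
  yields summability; the norm inequality then compares real numbers.\<close>

lemma lower_bound:
  assumes \<Phi>: "\<And>t. 0 \<le> \<Phi> t" and C: "0 \<le> C" and bd: "bounded_by \<Phi> C"
  shows "weight \<Phi> summable_on UNIV"
    and "W * radial_const * infsum (weight \<Phi>) UNIV \<le> C * (\<Prod>i<m. extremal_const i)"
proof -
  let ?a = "Lam - B - (real n + A) / Q"
  have "\<forall>i<m. extremal i \<in> MK_space p n (\<beta> i) (lam i) (l i) (q i) (pw p n (\<alpha> i))"
    using le_less_trans[OF extremal_MK ennreal_less_top] extremal_measurable by (simp add: MK_space_def)
  note bound = bd[unfolded H_bound_def, THEN spec, of extremal, THEN mp, OF this]
  have defined: "H_defined p n m \<Phi> \<Omega> extremal x" if "x \<in> qp_space p n" "x \<noteq> qp_zero" for x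
    using bound that by simp
  have le: "MK_norm p n B Lam L Q (pw p n A) (H_op p n m \<Phi> \<Omega> extremal)
       \<le> ennreal C * (\<Prod>i<m. MK_norm p n (\<beta> i) (lam i) (l i) (q i) (pw p n (\<alpha> i)) (extremal i))"
    using bound by simp
  obtain x where x: "x \<in> qp_space p n" "x \<noteq> qp_zero" by (rule nonzero_point)
  have "H_term p n m \<Phi> \<Omega> extremal x = (\<lambda>\<gamma>. complex_of_real (W * qp_norm p n x powr ?a * weight \<Phi> \<gamma>))"
    by (rule ext) (rule H_term_extremal[OF x])
  then have "(\<lambda>\<gamma>. complex_of_real (W * qp_norm p n x powr ?a * weight \<Phi> \<gamma>)) summable_on UNIV"
    using defined[OF x] by (simp only: H_defined_def)
  from summable_on_Re[OF this] have "(\<lambda>\<gamma>. W * qp_norm p n x powr ?a * weight \<Phi> \<gamma>) summable_on UNIV"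
    by simp
  then show sm: "weight \<Phi> summable_on UNIV"
    using W_pos norm_pos[OF x(2)] by (simp add: summable_on_cmult_right')
  have P0: "0 \<le> (\<Prod>i<m. extremal_const i)"
    using extremal_const_pos by (intro prod_nonneg) (auto intro: less_imp_le)
  have I0: "0 \<le> infsum (weight \<Phi>) UNIV" using \<Phi> by (intro infsum_nonneg) (simp add: weight_def)
  have "H_op p n m \<Phi> \<Omega> extremal x = complex_of_real (W * qp_norm p n x powr ?a * infsum (weight \<Phi>) UNIV)"
    if "x \<in> qp_space p n" "x \<noteq> qp_zero" for x
    unfolding H_op_def H_term_extremal[OF that]
    using has_sum_of_real[OF has_sum_cmult_right[OF has_sum_infsum[OF sm]]] by (rule infsumI)
  then have "cmod (H_op p n m \<Phi> \<Omega> extremal x) = (W * infsum (weight \<Phi>) UNIV) * qp_norm p n x powr ?a"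
    if "x \<in> qp_space p n" "x \<noteq> qp_zero" for x
    using that W_pos I0 by (simp add: norm_mult)
  \<comment> \<open>The image has the critical exponent again, so its norm is known exactly and
    nothing is lost on the left-hand side.\<close>
  then have norm_eq: "MK_norm p n B Lam L Q (pw p n A) (H_op p n m \<Phi> \<Omega> extremal) = ennreal (W * infsum (weight \<Phi>) UNIV * radial_const)"
    unfolding radial_const_def
    using W_pos I0 exponents_pos by (intro MK_norm_radial H_op_measurable) auto
  note le[unfolded norm_eq]
  also have "ennreal C * (\<Prod>i<m. MK_norm p n (\<beta> i) (lam i) (l i) (q i) (pw p n (\<alpha> i)) (extremal i)) \<le>
      ennreal C * (\<Prod>i<m. ennreal (extremal_const i))"
    by (intro mult_left_mono prod_mono_ennreal) (auto intro: extremal_MK)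
  also have "(\<Prod>i<m. ennreal (extremal_const i)) = ennreal (\<Prod>i<m. extremal_const i)"
    using extremal_const_pos by (intro prod_ennreal) (auto intro: less_imp_le)
  also have "ennreal C * \<dots> = ennreal (C * (\<Prod>i<m. extremal_const i))"
    using P0 by (rule ennreal_mult''[symmetric])
  finally show "W * radial_const * infsum (weight \<Phi>) UNIV \<le> C * (\<Prod>i<m. extremal_const i)"
    using C P0 by (simp add: ennreal_le_iff mult_ac)
qed

end

theorem theorem3p5:
  fixes p n m :: nat
    and q \<alpha> \<beta> l lam :: "nat \<Rightarrow> real"
    and \<Omega> :: "qpn \<Rightarrow> complex"
  assumes "prime p" and "1 \<le> n" and "1 \<le> m"
    and "\<forall>i<m. 1 \<le> q i" and "\<forall>i<m. - real n < \<alpha> i" and "\<forall>i<m. 1 \<le> l i"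
    and "\<forall>i<m. 0 < lam i"
    and "\<Omega> \<in> borel_measurable (restrict_space (qp_haar p n) (qp_sphere p n 0))"
    and "AE y in qp_haar p n. y \<in> qp_sphere p n 0 \<longrightarrow> \<Omega> y \<noteq> 0"
    and "Lp_on (qp_haar p n) (qp_sphere p n 0) (conj_exp (1 / (\<Sum>i<m. 1 / q i))) \<Omega>"
  shows "\<exists>c1 c2::real. 0 < c1 \<and> 0 < c2 \<and>
    (\<forall>\<Phi> :: qp1 \<Rightarrow> real. (\<forall>t. 0 \<le> \<Phi> t) \<longrightarrow>
      (let Q = 1 / (\<Sum>i<m. 1 / q i);
           A = Q * (\<Sum>i<m. \<alpha> i / q i);
           B = (\<Sum>i<m. \<beta> i);
           L = 1 / (\<Sum>i<m. 1 / l i);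
           Lam = (\<Sum>i<m. lam i);
           C5 = (\<Sum>\<^sub>\<infinity>\<gamma>::int. ennreal (\<Phi> (qp_pow \<gamma>) /
                   real p powr (real_of_int \<gamma> * (1 - B - (real n + A) / Q + Lam))));
           ws = (\<lambda>i. pw p n (\<alpha> i))
       in (H_bounded p n m \<Phi> \<Omega> \<beta> lam l q ws B Lam L Q (pw p n A) \<longleftrightarrow> C5 < \<infinity>) \<and>
          (C5 < \<infinity> \<longrightarrow>
             c1 * enn2real C5 \<le> H_opnorm p n m \<Phi> \<Omega> \<beta> lam l q ws B Lam L Q (pw p n A) \<and>
             H_opnorm p n m \<Phi> \<Omega> \<beta> lam l q ws B Lam L Q (pw p n A) \<le> c2 * enn2real C5)))"
proof -
  interpret rough_hausdorff p n m q \<alpha> \<beta> l lam \<Omega>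
    using assms prime_ge_2_nat by unfold_locales auto
  obtain c2 where c2: "0 < c2" and upper:
    "\<And>\<Phi>. (\<And>t. 0 \<le> \<Phi> t) \<Longrightarrow> weight \<Phi> summable_on UNIV \<Longrightarrow> bounded_by \<Phi> (c2 * infsum (weight \<Phi>) UNIV)"
    by (rule upper_bound) blast
  define P where "P = (\<Prod>i<m. extremal_const i)"
  have P: "0 < P" unfolding P_def using extremal_const_pos by (intro prod_pos) auto
  \<comment> \<open>The norm of the image of the extremal functions per unit of C5, divided by the
    bound for the product of their norms.\<close>
  define c1 where "c1 = W * radial_const / P"
  have c1: "0 < c1" using W_pos radial_const_pos P by (simp add: c1_def)
  have main: "(H_bounded p n m \<Phi> \<Omega> \<beta> lam l q (\<lambda>i. pw p n (\<alpha> i)) B Lam L Q (pw p n A)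
        \<longleftrightarrow> (\<Sum>\<^sub>\<infinity>\<gamma>. ennreal (weight \<Phi> \<gamma>)) < \<infinity>) \<and>
      ((\<Sum>\<^sub>\<infinity>\<gamma>. ennreal (weight \<Phi> \<gamma>)) < \<infinity> \<longrightarrow>
        c1 * enn2real (\<Sum>\<^sub>\<infinity>\<gamma>. ennreal (weight \<Phi> \<gamma>)) \<le>
          H_opnorm p n m \<Phi> \<Omega> \<beta> lam l q (\<lambda>i. pw p n (\<alpha> i)) B Lam L Q (pw p n A) \<and>
        H_opnorm p n m \<Phi> \<Omega> \<beta> lam l q (\<lambda>i. pw p n (\<alpha> i)) B Lam L Q (pw p n A) \<le>
          c2 * enn2real (\<Sum>\<^sub>\<infinity>\<gamma>. ennreal (weight \<Phi> \<gamma>)))"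
    if \<Phi>: "\<forall>t. 0 \<le> \<Phi> t" for \<Phi> :: "qp1 \<Rightarrow> real"
  proof -
    have w0: "0 \<le> weight \<Phi> \<gamma>" for \<gamma> using \<Phi> by (simp add: weight_def)
    then have I0: "0 \<le> infsum (weight \<Phi>) UNIV" by (intro infsum_nonneg) simp
    have fin_iff: "(\<Sum>\<^sub>\<infinity>\<gamma>. ennreal (weight \<Phi> \<gamma>)) < \<infinity> \<longleftrightarrow> weight \<Phi> summable_on UNIV"
      using w0 by (simp add: summable_on_iff_infsum_ennreal)
    have C5: "enn2real (\<Sum>\<^sub>\<infinity>\<gamma>. ennreal (weight \<Phi> \<gamma>)) = infsum (weight \<Phi>) UNIV"
      if "weight \<Phi> summable_on UNIV"
      using infsum_ennreal_eq[OF that] w0 I0 by simp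
    have low: "c1 * infsum (weight \<Phi>) UNIV \<le> C" if "0 \<le> C" "bounded_by \<Phi> C" for C
      using lower_bound(2)[of \<Phi> C] \<Phi> that P by (simp add: c1_def P_def field_simps)
    have bounded_iff: "H_bounded p n m \<Phi> \<Omega> \<beta> lam l q (\<lambda>i. pw p n (\<alpha> i)) B Lam L Q (pw p n A)
        \<longleftrightarrow> weight \<Phi> summable_on UNIV"
      unfolding H_bounded_def
      using lower_bound(1)[of \<Phi>] upper[of \<Phi>] \<Phi> c2 I0
      by (metis mult_nonneg_nonneg less_imp_le)
    let ?S = "{C. 0 \<le> C \<and> bounded_by \<Phi> C}"
    have "c1 * infsum (weight \<Phi>) UNIV \<le> Inf ?S \<and> Inf ?S \<le> c2 * infsum (weight \<Phi>) UNIV"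
      if sm: "weight \<Phi> summable_on UNIV"
    proof -
      \<comment> \<open>Makes the set nonempty, without which its real infimum would carry no
        information, and bounds that infimum from above.\<close>
      have mem: "c2 * infsum (weight \<Phi>) UNIV \<in> ?S"
        using upper[OF _ sm] \<Phi> c2 I0 by simp
      have "c1 * infsum (weight \<Phi>) UNIV \<le> Inf ?S"
        by (rule cInf_greatest) (use mem low in blast)+
      moreover have "Inf ?S \<le> c2 * infsum (weight \<Phi>) UNIV"
        by (rule cInf_lower[OF mem]) (auto intro!: bdd_belowI[of _ 0])
      ultimately show ?thesis ..
    qed
    then show ?thesis
      unfolding fin_iff bounded_iff H_opnorm_def using C5 by simp
  qed
  show ?thesis
    unfolding Let_def
    using c1 c2 main
    unfolding weight_def Q_def A_def B_def L_def Lam_def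
    by blast
qed

end
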